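(* Let $F$ be a vertex-critical graph with $\chi(F)\geq 3$, and let $h\geq 2$ be an integer. Then, for all sufficiently large $n$, $$\mathrm{ex}(n,hF)=\max_{1\leq \ell\leq h}\left\{\binom{\ell-1}{2}+(\ell-1)(n-\ell+1)+\mathrm{ex}(n-\ell+1,F)\right\}=\binom{h-1}{2}+(h-1)(n-h+1)+\mathrm{ex}(n-h+1,F).$$ Moreover, every graph in $\mathrm{EX}(n,hF)$ is of the form $K_{h-1}\prod H$, where $H\in\mathrm{EX}(n-h+1,F)$.
   Context: All graphs are finite, simple and undirected; $\chi(G)$ is the chromatic number. For a graph $F$, a graph $G$ is $F$-free if it contains no subgraph isomorphic to $F$; $\mathrm{EX}(n,F)$ is the set of $F$-free graphs on $n$ vertices with the maximum possible number of edges, and $\mathrm{ex}(n,F)$ is the number of edges of any graph in $\mathrm{EX}(n,F)$. A graph $F$ is vertex-critical if there is a vertex $u$ of $F$ with $\chi(F-u)=\chi(F)-1$. $hF$ denotes the vertex-disjoint union of $h$ copies of $F$. For graphs $G_1,G_2$, $G_1\prod G_2$ denotes the join: the disjoint union of $G_1$ and $G_2$ together with all edges between $V(G_1)$ and $V(G_2)$. $K_m$ is the complete graph on $m$ vertices, and $\binom{a}{2}=0$ for $a\in\{0,1\}$. *)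

theory Defs
  imports Complex_Main
begin

type_synonym 'a graph = "'a set \<times> 'a set set"

abbreviation verts :: "'a graph \<Rightarrow> 'a set" where "verts G \<equiv> fst G"
abbreviation edges :: "'a graph \<Rightarrow> 'a set set" where "edges G \<equiv> snd G"

definition sgraph :: "'a graph \<Rightarrow> bool" where
  "sgraph G \<longleftrightarrow> finite (verts G) \<and> (\<forall>e\<in>edges G. e \<subseteq> verts G \<and> card e = 2)"

definition proper_coloring :: "'a graph \<Rightarrow> nat \<Rightarrow> ('a \<Rightarrow> nat) \<Rightarrow> bool" where
  "proper_coloring G k c \<longleftrightarrow>
     c ` verts G \<subseteq> {..<k} \<and> (\<forall>u v. {u, v} \<in> edges G \<longrightarrow> c u \<noteq> c v)"

definition chromatic_number :: "'a graph \<Rightarrow> nat" where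
  "chromatic_number G = (LEAST k. \<exists>c. proper_coloring G k c)"

definition del_vert :: "'a graph \<Rightarrow> 'a \<Rightarrow> 'a graph" where
  "del_vert G u = (verts G - {u}, {e \<in> edges G. u \<notin> e})"

definition vertex_critical :: "'a graph \<Rightarrow> bool" where
  "vertex_critical G \<longleftrightarrow>
     (\<exists>u\<in>verts G. chromatic_number (del_vert G u) = chromatic_number G - 1)"

definition subgraph :: "'a graph \<Rightarrow> 'a graph \<Rightarrow> bool" where
  "subgraph H G \<longleftrightarrow> sgraph H \<and> verts H \<subseteq> verts G \<and> edges H \<subseteq> edges G"

definition isomorphic :: "'a graph \<Rightarrow> 'b graph \<Rightarrow> bool" where
  "isomorphic G H \<longleftrightarrow>
     (\<exists>f. bij_betw f (verts G) (verts H) \<and> edges H = (\<lambda>e. f ` e) ` edges G)"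

definition free_of :: "'a graph \<Rightarrow> 'b graph \<Rightarrow> bool" where
  "free_of F G \<longleftrightarrow> \<not> (\<exists>H. subgraph H G \<and> isomorphic F H)"

text \<open>
  Host graphs have vertices of type \<^typ>\<open>nat\<close>; every finite graph is isomorphic to such a graph.
  The vertex set itself is only constrained to have \<open>n\<close> elements.
\<close>

definition EX_set :: "nat \<Rightarrow> 'a graph \<Rightarrow> nat graph set" where
  "EX_set n F = {G. sgraph G \<and> card (verts G) = n \<and> free_of F G \<and>
     (\<forall>G' :: nat graph. sgraph G' \<and> card (verts G') = n \<and> free_of F G' \<longrightarrow>
        card (edges G') \<le> card (edges G))}"

text \<open>The description is well defined whenever some \<open>F\<close>-free graph on \<open>n\<close> vertices exists.\<close>

definition ex_num :: "nat \<Rightarrow> 'a graph \<Rightarrow> nat" where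
  "ex_num n F = (THE m. \<exists>G\<in>EX_set n F. card (edges G) = m)"

definition copies :: "nat \<Rightarrow> 'a graph \<Rightarrow> (nat \<times> 'a) graph" where
  "copies h F = ({..<h} \<times> verts F, {Pair i ` e | i e. i < h \<and> e \<in> edges F})"

definition join :: "'a graph \<Rightarrow> 'b graph \<Rightarrow> ('a + 'b) graph" where
  "join G H = (verts G <+> verts H,
     (\<lambda>e. Inl ` e) ` edges G \<union> (\<lambda>e. Inr ` e) ` edges H \<union>
     {{Inl u, Inr v} | u v. u \<in> verts G \<and> v \<in> verts H})"

definition complete_graph :: "nat \<Rightarrow> nat graph" where
  "complete_graph m = ({..<m}, {e. e \<subseteq> {..<m} \<and> card e = 2})"

lemma card_edges_EX_set:
  assumes "G \<in> EX_set n F"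
  shows "card (edges G) = ex_num n F"
  unfolding ex_num_def
proof (rule sym, rule the_equality)
  show "\<exists>H\<in>EX_set n F. card (edges H) = card (edges G)" using assms by blast
next
  fix m assume "\<exists>H\<in>EX_set n F. card (edges H) = m"
  then obtain H where "H \<in> EX_set n F" "card (edges H) = m" by blast
  then show "m = card (edges G)" using assms unfolding EX_set_def mem_Collect_eq by (metis le_antisym)
qed

lemma EX_set_nonempty:
  assumes "sgraph (G :: nat graph)" "card (verts G) = n" "free_of F G"
  shows "EX_set n F \<noteq> {}"
proof -
  let ?P = "\<lambda>G :: nat graph. sgraph G \<and> card (verts G) = n \<and> free_of F G"
  have bnd: "\<forall>G. ?P G \<longrightarrow> card (edges G) < Suc (2 ^ n)"
  proof (intro allI impI)
    fix G assume P: "?P G"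
    then have "edges G \<subseteq> Pow (verts G)" "finite (verts G)" by (auto simp: sgraph_def)
    then have "card (edges G) \<le> card (Pow (verts G))" by (intro card_mono) auto
    then show "card (edges G) < Suc (2 ^ n)" using P \<open>finite (verts G)\<close> by (simp add: card_Pow)
  qed
  have "?P G" using assms by blast
  from ex_has_greatest_nat[of ?P G "\<lambda>G. card (edges G)", OF this bnd]
  obtain M where "?P M" "\<forall>G'. ?P G' \<longrightarrow> card (edges G') \<le> card (edges M)" by blast
  then have "M \<in> EX_set n F" by (simp add: EX_set_def)
  then show ?thesis by blast
qed

end

theory Submission
  imports Defs "HOL-Library.FuncSet"
begin

text \<open>
  Write \<open>\<chi>(F) = r + 1\<close>, \<open>p = 1 - 1/r\<close> and \<open>k = |F|\<close>, and let \<open>A\<close> be the set of vertices of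
  degree at least \<open>(p + \<epsilon>) n\<close> in an extremal \<open>hF\<close>-free graph \<open>G\<close>. By the Erdos--Stone theorem
  almost all degrees in \<open>G\<close> are at least \<open>(p - \<epsilon>) n\<close>, so the neighbourhood of a vertex \<open>v \<in> A\<close>
  contains a complete \<open>r\<close>-partite graph \<open>K\<^sub>r(k)\<close> even after deleting boundedly many vertices. As
  \<open>F\<close> is vertex-critical, this gives a copy of \<open>F\<close> through \<open>v\<close> that avoids any prescribed bounded
  set. Hence disjoint copies of \<open>F\<close> outside \<open>A\<close> together with the vertices of \<open>A\<close> number at most
  \<open>h - 1\<close>. If \<open>|A| = h - 1\<close>, then \<open>G - A\<close> is \<open>F\<close>-free, and counting edges shows that \<open>G\<close> is
  \<open>K\<^bsub>h-1\<^esub>\<close> joined to an extremal \<open>F\<close>-free graph.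

  If \<open>|A| < h - 1\<close>, deleting \<open>A\<close> and the boundedly many vertices of a maximal packing outside \<open>A\<close>,
  all of degree below \<open>(p + \<epsilon>) n\<close>, leaves an \<open>F\<close>-free graph, so \<open>G\<close> has too few edges. This
  comparison needs \<open>ex(n + 1, F) \<ge> ex(n, F) + (p - \<epsilon>) n\<close>: in an extremal \<open>F\<close>-free graph some \<open>k\<close>
  vertices have a common neighbourhood \<open>W\<close> of size at least \<open>(p - \<epsilon>) n\<close>, and a new vertex joined
  to \<open>W\<close> creates no copy of \<open>F\<close>.
\<close>

subsection \<open>Degrees and edge density\<close>

definition neighbours :: "'a graph \<Rightarrow> 'a \<Rightarrow> 'a set" where
  "neighbours G v = {x. {v, x} \<in> edges G}"

definition degree :: "'a graph \<Rightarrow> 'a \<Rightarrow> nat" where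
  "degree G v = card (neighbours G v)"

definition high_degree_verts :: "'a graph \<Rightarrow> real \<Rightarrow> 'a set" where
  "high_degree_verts G d = {v \<in> verts G. d \<le> degree G v}"

definition common_neighbours :: "'a graph \<Rightarrow> 'a set \<Rightarrow> 'a set" where
  "common_neighbours G S = {x \<in> verts G. S \<subseteq> neighbours G x}"

definition edge_density :: "'a graph \<Rightarrow> real" where
  "edge_density G = 2 * card (edges G) / real (card (verts G)) ^ 2"

definition induced :: "'a graph \<Rightarrow> 'a set \<Rightarrow> 'a graph" where
  "induced G S = (S, {e \<in> edges G. e \<subseteq> S})"

abbreviation del_verts :: "'a graph \<Rightarrow> 'a set \<Rightarrow> 'a graph" where
  "del_verts G X \<equiv> induced G (verts G - X)"

lemma finite_verts [simp]: "sgraph G \<Longrightarrow> finite (verts G)"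
  by (simp add: sgraph_def)

lemma finite_edges [simp]: "sgraph G \<Longrightarrow> finite (edges G)"
  by (rule finite_subset[of _ "Pow (verts G)"]) (auto simp: sgraph_def)

lemma edge_subset_verts: "sgraph G \<Longrightarrow> e \<in> edges G \<Longrightarrow> e \<subseteq> verts G"
  by (simp add: sgraph_def)

lemma edge_not_empty: "sgraph G \<Longrightarrow> e \<in> edges G \<Longrightarrow> e \<noteq> {}"
  by (force simp: sgraph_def)

lemma edgeE:
  assumes "sgraph G" "e \<in> edges G"
  obtains x y where "e = {x, y}" "x \<noteq> y" "x \<in> verts G" "y \<in> verts G"
  using assms by (auto simp: sgraph_def card_2_iff)

lemma edge_at_vertexE:
  assumes "sgraph G" "e \<in> edges G" "v \<in> e"
  obtains x where "e = {v, x}" "x \<noteq> v" "x \<in> verts G"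
  using edgeE[OF assms(1,2)] assms(3) by (metis insert_commute insertE singletonD)

lemma mem_neighbours_commute: "x \<in> neighbours G y \<longleftrightarrow> y \<in> neighbours G x"
  by (simp add: neighbours_def insert_commute)

lemma neighbours_subset_verts: "sgraph G \<Longrightarrow> neighbours G v \<subseteq> verts G"
  by (auto simp: neighbours_def sgraph_def)

lemma not_mem_neighbours_self: "sgraph G \<Longrightarrow> v \<notin> neighbours G v"
  by (force simp: neighbours_def sgraph_def)

lemma finite_neighbours [simp]: "sgraph G \<Longrightarrow> finite (neighbours G v)"
  by (meson finite_subset finite_verts neighbours_subset_verts)

lemma high_degree_verts_subset: "high_degree_verts G d \<subseteq> verts G"
  by (auto simp: high_degree_verts_def)

lemma degree_le_card_verts: "sgraph G \<Longrightarrow> degree G v \<le> card (verts G)"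
  by (simp add: degree_def card_mono neighbours_subset_verts)

lemma verts_induced [simp]: "verts (induced G S) = S"
  by (simp add: induced_def)

lemma edges_induced [simp]: "edges (induced G S) = {e \<in> edges G. e \<subseteq> S}"
  by (simp add: induced_def)

lemma induced_induced: "T \<subseteq> S \<Longrightarrow> induced (induced G S) T = induced G T"
  by (auto simp: induced_def)

lemma del_verts_del_verts: "del_verts (del_verts G A) C = del_verts G (A \<union> C)"
  by (auto simp: induced_def)

lemma subgraph_induced: "sgraph G \<Longrightarrow> S \<subseteq> verts G \<Longrightarrow> subgraph (induced G S) G"
  by (auto simp: subgraph_def sgraph_def intro: finite_subset)

lemma sgraph_induced: "sgraph G \<Longrightarrow> S \<subseteq> verts G \<Longrightarrow> sgraph (induced G S)"
  using subgraph_induced[of G S] by (simp add: subgraph_def)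

lemma subgraph_induced_mono:
  assumes "sgraph G" "S \<subseteq> T" "T \<subseteq> verts G"
  shows "subgraph (induced G S) (induced G T)"
  using subgraph_induced[OF sgraph_induced[OF assms(1,3)], of S] assms(2)
  by (simp add: induced_induced)

lemma neighbours_induced: "v \<in> S \<Longrightarrow> neighbours (induced G S) v = neighbours G v \<inter> S"
  by (auto simp: neighbours_def)

lemma card_verts_Diff:
  assumes "sgraph G" "S \<subseteq> verts G"
  shows "real (card (verts G - S)) = real (card (verts G)) - card S"
  using assms by (simp add: card_Diff_subset card_mono finite_subset of_nat_diff)

lemma degree_induced_ge:
  assumes "sgraph G" "S \<subseteq> verts G" "v \<in> S"
  shows "real (degree G v) \<le> degree (induced G S) v + (real (card (verts G)) - card S)"
proof -
  have "neighbours G v \<subseteq> neighbours (induced G S) v \<union> (verts G - S)"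
    using neighbours_subset_verts[OF assms(1), of v] assms(3) by (auto simp: neighbours_induced)
  then have "degree G v \<le> card (neighbours (induced G S) v \<union> (verts G - S))"
    unfolding degree_def using assms by (intro card_mono) (auto simp: sgraph_induced)
  also have "\<dots> \<le> degree (induced G S) v + card (verts G - S)"
    unfolding degree_def by (rule card_Un_le)
  finally have "real (degree G v) \<le> degree (induced G S) v + card (verts G - S)" by linarith
  then show ?thesis by (simp add: card_verts_Diff[OF assms(1,2)])
qed

lemma card_incident_edges:
  assumes "sgraph G"
  shows "card {e \<in> edges G. v \<in> e} = degree G v"
proof -
  have "{e \<in> edges G. v \<in> e} = (\<lambda>x. {v, x}) ` neighbours G v"
    by (auto simp: neighbours_def elim: edge_at_vertexE[OF assms])
  moreover have "inj_on (\<lambda>x. {v, x}) (neighbours G v)" by (auto simp: inj_on_def doubleton_eq_iff)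
  ultimately show ?thesis by (simp add: card_image degree_def)
qed

lemma sum_degree:
  assumes "sgraph G"
  shows "(\<Sum>v\<in>verts G. degree G v) = 2 * card (edges G)"
proof -
  have "card {v \<in> verts G. v \<in> e} = 2" if "e \<in> edges G" for e
  proof -
    have "{v \<in> verts G. v \<in> e} = e" using edge_subset_verts[OF assms that] by blast
    then show ?thesis using assms that by (simp add: sgraph_def)
  qed
  then have "(\<Sum>v\<in>verts G. card {e \<in> edges G. v \<in> e}) = 2 * card (edges G)"
    using assms by (intro sum_multicount) auto
  then show ?thesis by (simp add: card_incident_edges[OF assms])
qed

lemma double_card_edges:
  assumes "sgraph G"
  shows "2 * real (card (edges G)) = edge_density G * real (card (verts G)) ^ 2"
proof (cases "verts G = {}")
  case True
  then show ?thesis using sum_degree[OF assms] by simp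
qed (use assms in \<open>simp add: edge_density_def\<close>)

lemma edge_density_le_one:
  assumes "sgraph G"
  shows "edge_density G \<le> 1"
proof -
  have "2 * card (edges G) \<le> card (verts G) * card (verts G)"
    using sum_bounded_above[of "verts G" "degree G"] degree_le_card_verts[OF assms]
    by (simp flip: sum_degree[OF assms])
  then have "2 * real (card (edges G)) \<le> card (verts G) * card (verts G)"
    by (metis of_nat_le_iff of_nat_mult of_nat_numeral)
  then show ?thesis by (simp add: edge_density_def power2_eq_square divide_le_eq)
qed

lemma card_edges_le_del_verts:
  assumes "sgraph G" "finite X"
  shows "card (edges G) \<le> card (edges (del_verts G X)) + (\<Sum>v\<in>X. degree G v)"
proof -
  have "edges G \<subseteq> edges (del_verts G X) \<union> (\<Union>v\<in>X. {e \<in> edges G. v \<in> e})"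
    using edge_subset_verts[OF assms(1)] by auto
  then have "card (edges G) \<le> card (edges (del_verts G X) \<union> (\<Union>v\<in>X. {e \<in> edges G. v \<in> e}))"
    using assms by (intro card_mono) auto
  also have "\<dots> \<le> card (edges (del_verts G X)) + card (\<Union>v\<in>X. {e \<in> edges G. v \<in> e})"
    by (rule card_Un_le)
  also have "card (\<Union>v\<in>X. {e \<in> edges G. v \<in> e}) \<le> (\<Sum>v\<in>X. card {e \<in> edges G. v \<in> e})"
    using assms(2) by (rule card_UN_le)
  finally show ?thesis by (simp add: card_incident_edges[OF assms(1)])
qed

lemma sum_card_non_neighbours_swap:
  assumes "finite A" "finite B"
  shows "(\<Sum>v\<in>A. card (B - neighbours G v)) = (\<Sum>x\<in>B. card (A - neighbours G x))"
proof -
  have "(\<Sum>v\<in>A. card {x \<in> B. x \<notin> neighbours G v}) = (\<Sum>x\<in>B. card {v \<in> A. v \<notin> neighbours G x})"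
    using assms by (intro sum_multicount_gen) (auto simp: mem_neighbours_commute)
  then show ?thesis by (simp add: set_diff_eq)
qed

subsection \<open>Embeddings and colourings\<close>

definition embeds_via :: "('a \<Rightarrow> 'b) \<Rightarrow> 'a graph \<Rightarrow> 'b graph \<Rightarrow> bool" where
  "embeds_via f F G \<longleftrightarrow>
     inj_on f (verts F) \<and> f ` verts F \<subseteq> verts G \<and> (\<forall>e\<in>edges F. f ` e \<in> edges G)"

definition map_graph :: "('a \<Rightarrow> 'b) \<Rightarrow> 'a graph \<Rightarrow> 'b graph" where
  "map_graph f G = (f ` verts G, (`) f ` edges G)"

lemma verts_map_graph [simp]: "verts (map_graph f G) = f ` verts G"
  by (simp add: map_graph_def)

lemma edges_map_graph [simp]: "edges (map_graph f G) = (`) f ` edges G"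
  by (simp add: map_graph_def)

lemma isomorphic_iff_map_graph: "isomorphic G H \<longleftrightarrow> (\<exists>f. inj_on f (verts G) \<and> H = map_graph f G)"
  by (auto simp: isomorphic_def bij_betw_def prod_eq_iff)

lemma inj_on_image_edges: "sgraph G \<Longrightarrow> inj_on f (verts G) \<Longrightarrow> inj_on ((`) f) (edges G)"
  by (meson PowI edge_subset_verts inj_on_image_Pow inj_on_subset subsetI)

lemma sgraph_map_graph:
  assumes "sgraph G" "inj_on f (verts G)"
  shows "sgraph (map_graph f G)"
  using assms card_image inj_on_subset[OF assms(2)] by (fastforce simp: sgraph_def)

lemma card_edges_map_graph:
  "sgraph G \<Longrightarrow> inj_on f (verts G) \<Longrightarrow> card (edges (map_graph f G)) = card (edges G)"
  by (simp add: card_image inj_on_image_edges)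

lemma free_of_iff_embeds:
  assumes "sgraph F"
  shows "free_of F G \<longleftrightarrow> (\<nexists>f. embeds_via f F G)"
proof -
  have "embeds_via f F G \<longleftrightarrow> inj_on f (verts F) \<and> subgraph (map_graph f F) G" for f
    using sgraph_map_graph[OF assms, of f] by (auto simp: embeds_via_def subgraph_def)
  then show ?thesis unfolding free_of_def isomorphic_iff_map_graph by blast
qed

lemma not_free_ofI: "sgraph F \<Longrightarrow> embeds_via f F G \<Longrightarrow> \<not> free_of F G"
  by (auto simp: free_of_iff_embeds)

lemma not_free_ofE:
  assumes "sgraph F" "\<not> free_of F G"
  obtains f where "embeds_via f F G"
  using assms by (auto simp: free_of_iff_embeds)

lemma subgraph_trans: "subgraph K H \<Longrightarrow> subgraph H G \<Longrightarrow> subgraph K G"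
  unfolding subgraph_def by (meson order_trans)

lemma free_of_subgraph: "free_of F G \<Longrightarrow> subgraph H G \<Longrightarrow> free_of F H"
  unfolding free_of_def by (meson subgraph_trans)

lemma free_of_map_graph:
  assumes "sgraph F" "sgraph G" "free_of F G" "inj_on f (verts G)"
  shows "free_of F (map_graph f G)"
proof (rule ccontr)
  assume "\<not> free_of F (map_graph f G)"
  then obtain g where g: "embeds_via g F (map_graph f G)" by (rule not_free_ofE[OF assms(1)])
  have "embeds_via (inv_into (verts G) f \<circ> g) F G"
    unfolding embeds_via_def
  proof (intro conjI ballI)
    show "inj_on (inv_into (verts G) f \<circ> g) (verts F)"
      using g by (auto simp: embeds_via_def intro!: comp_inj_on inj_on_inv_into)
    show "(inv_into (verts G) f \<circ> g) ` verts F \<subseteq> verts G"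
      using g by (auto simp: embeds_via_def intro!: inv_into_into)
    fix e assume "e \<in> edges F"
    then obtain d where d: "g ` e = f ` d" "d \<in> edges G" using g by (auto simp: embeds_via_def)
    then have "(inv_into (verts G) f \<circ> g) ` e = d"
      using edge_subset_verts[OF assms(2)] assms(4)
      by (simp del: o_apply add: image_comp[symmetric])
    then show "(inv_into (verts G) f \<circ> g) ` e \<in> edges G" using d(2) by simp
  qed
  then show False using assms(1,3) by (auto simp: free_of_iff_embeds)
qed

lemma not_free_of_obtain_support:
  assumes "sgraph F" "\<not> free_of F G"
  obtains X where "X \<subseteq> verts G" "finite X" "card X = card (verts F)" "\<not> free_of F (induced G X)"
proof -
  obtain f where f: "embeds_via f F G" using assms by (rule not_free_ofE)
  then have "embeds_via f F (induced G (f ` verts F))"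
    using edge_subset_verts[OF assms(1)] by (auto simp: embeds_via_def)
  then have "\<not> free_of F (induced G (f ` verts F))" by (rule not_free_ofI[OF assms(1)])
  moreover have "inj_on f (verts F)" "f ` verts F \<subseteq> verts G"
    using f by (simp_all add: embeds_via_def)
  ultimately show thesis using that assms(1) by (simp add: card_image)
qed

lemma chromatic_number_le: "proper_coloring G k c \<Longrightarrow> chromatic_number G \<le> k"
  unfolding chromatic_number_def by (rule Least_le) (rule exI)

lemma chromatic_number_coloring:
  assumes "sgraph G"
  obtains c where "proper_coloring G (chromatic_number G) c"
proof -
  obtain c :: "'a \<Rightarrow> nat" and n where "inj_on c (verts G)" "c ` verts G = {..<n}"
    using finite_imp_inj_to_nat_seg[of "verts G"] assms by (metis finite_verts lessThan_def)
  moreover have "c u \<noteq> c v" if "{u, v} \<in> edges G" for u v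
  proof -
    obtain x y where "{u, v} = {x, y}" "x \<noteq> y" "x \<in> verts G" "y \<in> verts G"
      using edgeE[OF assms \<open>{u, v} \<in> edges G\<close>] .
    then show ?thesis using \<open>inj_on c (verts G)\<close> by (metis doubleton_eq_iff inj_onD)
  qed
  ultimately have "proper_coloring G n c" by (simp add: proper_coloring_def)
  then show thesis
    using that LeastI[of "\<lambda>k. \<exists>c. proper_coloring G k c" n] unfolding chromatic_number_def by blast
qed

lemma proper_coloring_comp:
  assumes "f ` verts F \<subseteq> verts G" "\<And>e. e \<in> edges F \<Longrightarrow> f ` e \<in> edges G" "proper_coloring G k c"
  shows "proper_coloring F k (c \<circ> f)"
proof -
  have "(c \<circ> f) u \<noteq> (c \<circ> f) v" if "{u, v} \<in> edges F" for u v
    using assms(2)[OF that] assms(3) by (simp add: proper_coloring_def)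
  moreover have "(c \<circ> f) ` verts F \<subseteq> {..<k}"
    using assms(1,3) unfolding proper_coloring_def image_comp[symmetric] by blast
  ultimately show ?thesis by (simp add: proper_coloring_def)
qed

lemma free_of_if_chromatic_number_greater:
  assumes "sgraph F" "proper_coloring G r c" "r < chromatic_number F"
  shows "free_of F G"
proof -
  have "chromatic_number F \<le> r" if "embeds_via f F G" for f
    using that assms(2)
    by (intro chromatic_number_le[of F r "c \<circ> f"] proper_coloring_comp) (auto simp: embeds_via_def)
  then show ?thesis using assms(1,3) by (auto simp: free_of_iff_embeds)
qed

subsection \<open>Complete multipartite subgraphs with equal parts\<close>

definition blowup_parts :: "'a graph \<Rightarrow> nat \<Rightarrow> nat \<Rightarrow> (nat \<Rightarrow> 'a set) \<Rightarrow> bool" where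
  "blowup_parts G r t P \<longleftrightarrow> (\<forall>i<r. P i \<subseteq> verts G \<and> card (P i) = t) \<and>
     (\<forall>i<r. \<forall>j<r. i \<noteq> j \<longrightarrow> (\<forall>x\<in>P i. P j \<subseteq> neighbours G x))"

definition has_blowup :: "'a graph \<Rightarrow> nat \<Rightarrow> nat \<Rightarrow> bool" where
  "has_blowup G r t \<longleftrightarrow> (\<exists>P. blowup_parts G r t P)"

definition rich_verts :: "'a graph \<Rightarrow> nat \<Rightarrow> nat \<Rightarrow> (nat \<Rightarrow> 'a set) \<Rightarrow> 'a set" where
  "rich_verts G r t P = {x \<in> verts G. \<forall>i<r. t \<le> card (neighbours G x \<inter> P i)}"

lemma has_blowup_zero: "has_blowup G r 0"
  unfolding has_blowup_def blowup_parts_def by (intro exI[of _ "\<lambda>_. {}"]) simp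

lemma finite_blowup_part: "sgraph G \<Longrightarrow> blowup_parts G r t P \<Longrightarrow> i < r \<Longrightarrow> finite (P i)"
  unfolding blowup_parts_def by (meson finite_subset finite_verts)

lemma blowup_parts_induced_mono:
  assumes "S \<subseteq> T" "blowup_parts (induced G S) r t P"
  shows "blowup_parts (induced G T) r t P"
  using assms by (fastforce simp: blowup_parts_def neighbours_def)

lemma blowup_parts_induced:
  assumes "S \<subseteq> verts G" "blowup_parts (induced G S) r t P"
  shows "blowup_parts G r t P"
  using assms by (fastforce simp: blowup_parts_def neighbours_def)

lemma has_blowup_induced_mono:
  "S \<subseteq> T \<Longrightarrow> has_blowup (induced G S) r t \<Longrightarrow> has_blowup (induced G T) r t"
  unfolding has_blowup_def using blowup_parts_induced_mono by blast

lemma has_blowup_induced: "S \<subseteq> verts G \<Longrightarrow> has_blowup (induced G S) r t \<Longrightarrow> has_blowup G r t"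
  unfolding has_blowup_def using blowup_parts_induced by blast

lemma blowup_parts_shrink:
  assumes "blowup_parts G r T P" "\<And>i. i < r \<Longrightarrow> R i \<subseteq> P i \<and> card (R i) = t"
  shows "blowup_parts G r t R"
  using assms unfolding blowup_parts_def by (meson subset_iff)

lemma has_blowup_antimono:
  assumes "s \<le> t" "has_blowup G r t"
  shows "has_blowup G r s"
proof -
  obtain P where P: "blowup_parts G r t P" using assms(2) by (auto simp: has_blowup_def)
  then have "\<exists>R. R \<subseteq> P i \<and> card R = s" if "i < r" for i
    using that assms(1) obtain_subset_with_card_n[of s "P i"] by (auto simp: blowup_parts_def)
  then obtain R where "\<And>i. i < r \<Longrightarrow> R i \<subseteq> P i \<and> card (R i) = s" by metis
  then have "blowup_parts G r s R" by (rule blowup_parts_shrink[OF P])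
  then show ?thesis by (auto simp: has_blowup_def)
qed

lemma blowup_parts_add_part:
  assumes "blowup_parts G r t R" "Q \<subseteq> verts G" "card Q = t"
    and "\<And>i x. i < r \<Longrightarrow> x \<in> Q \<Longrightarrow> R i \<subseteq> neighbours G x"
  shows "blowup_parts G (Suc r) t (R(r := Q))"
proof -
  have "Q \<subseteq> neighbours G y" if "i < r" "y \<in> R i" for i y
    using assms(4)[OF that(1)] that(2) mem_neighbours_commute by fast
  then show ?thesis using assms unfolding blowup_parts_def less_Suc_eq by auto
qed

lemma obtain_subset_with_equal_images:
  assumes "f \<in> A \<rightarrow> B" "finite A" "finite B" "t * card B < card A"
  obtains Q y where "Q \<subseteq> A" "card Q = t" "\<And>x. x \<in> Q \<Longrightarrow> f x = y"
proof -
  have "A \<noteq> {}" using assms(4) by auto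
  then have "B \<noteq> {}" using assms(1) by auto
  then obtain y where "card A \<le> card (f -` {y} \<inter> A) * card B"
    using pigeonhole_card[OF assms(1-3)] by blast
  then have "t * card B < card (f -` {y} \<inter> A) * card B" using assms(4) by linarith
  then obtain Q where "Q \<subseteq> f -` {y} \<inter> A" "card Q = t"
    by (metis less_imp_le mult_less_cancel2 obtain_subset_with_card_n)
  then show thesis using that[of Q y] by blast
qed

lemma has_blowup_Suc_if_many_rich_verts:
  assumes "sgraph G" "blowup_parts G r T P" "t * 2 ^ (r * T) < card (rich_verts G r t P)"
  shows "has_blowup G (Suc r) t"
proof -
  define K where "K = (\<Union>i<r. P i)"
  have P: "card (P i) = T" if "i < r" for i
    using assms(2) that by (simp add: blowup_parts_def)
  have "finite K" using finite_blowup_part[OF assms(1,2)] by (auto simp: K_def)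
  have "card K \<le> (\<Sum>i<r. card (P i))" unfolding K_def by (rule card_UN_le) simp
  then have "card (Pow K) \<le> 2 ^ (r * T)" using P \<open>finite K\<close> by (simp add: card_Pow)
  then have "t * card (Pow K) < card (rich_verts G r t P)"
    using assms(3) by (meson le_less_trans mult_le_mono2)
  then obtain Q Y where Q: "Q \<subseteq> rich_verts G r t P" "card Q = t"
    and Y: "\<And>x. x \<in> Q \<Longrightarrow> neighbours G x \<inter> K = Y"
    using obtain_subset_with_equal_images[of "\<lambda>x. neighbours G x \<inter> K" "rich_verts G r t P" "Pow K" t]
      \<open>finite K\<close> assms(1) by (auto simp: rich_verts_def)
  show ?thesis
  proof (cases "t = 0")
    case True
    then show ?thesis by (simp add: has_blowup_zero)
  next
    case False
    then obtain q where "q \<in> Q" using Q(2) by fastforce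
    have "\<exists>R. R \<subseteq> Y \<inter> P i \<and> card R = t" if "i < r" for i
    proof -
      have "t \<le> card (neighbours G q \<inter> P i)" using \<open>q \<in> Q\<close> Q(1) that by (auto simp: rich_verts_def)
      also have "neighbours G q \<inter> P i = Y \<inter> P i" using Y[OF \<open>q \<in> Q\<close>] that by (auto simp: K_def)
      finally show ?thesis by (meson obtain_subset_with_card_n)
    qed
    then obtain R where R: "\<And>i. i < r \<Longrightarrow> R i \<subseteq> Y \<inter> P i \<and> card (R i) = t" by metis
    have "blowup_parts G r t R" by (rule blowup_parts_shrink[OF assms(2)]) (use R in blast)
    moreover have "R i \<subseteq> neighbours G x" if "i < r" "x \<in> Q" for i x
      using R[OF that(1)] Y[OF that(2)] by blast
    ultimately have "blowup_parts G (Suc r) t (R(r := Q))"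
      using Q by (intro blowup_parts_add_part) (auto simp: rich_verts_def)
    then show ?thesis by (auto simp: has_blowup_def)
  qed
qed

text \<open>Counting non-neighbours instead of neighbours turns the later case distinctions into lower
  bounds for sums of nonnegative terms.\<close>

lemma sum_non_neighbours_blowup_parts_le:
  fixes d :: real
  assumes "sgraph G" "blowup_parts G r T P" "\<And>i v. i < r \<Longrightarrow> v \<in> P i \<Longrightarrow> d \<le> degree G v"
  shows "(\<Sum>x\<in>verts G. \<Sum>i<r. real (card (P i - neighbours G x))) \<le> real r * T * (card (verts G) - d)"
proof -
  have P: "P i \<subseteq> verts G" "card (P i) = T" if "i < r" for i
    using assms(2) that by (auto simp: blowup_parts_def)
  have "(\<Sum>x\<in>verts G. real (card (P i - neighbours G x))) \<le> T * (card (verts G) - d)" if "i < r" for i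
  proof -
    have "(\<Sum>x\<in>verts G. real (card (P i - neighbours G x))) =
        real (\<Sum>v\<in>P i. card (verts G - neighbours G v))"
      using finite_blowup_part[OF assms(1,2) that] assms(1)
      by (simp add: sum_card_non_neighbours_swap)
    also have "\<dots> = (\<Sum>v\<in>P i. real (card (verts G)) - degree G v)"
      using assms(1) neighbours_subset_verts[OF assms(1)] degree_le_card_verts[OF assms(1)]
      by (simp add: card_Diff_subset degree_def of_nat_diff)
    also have "\<dots> \<le> (\<Sum>v\<in>P i. card (verts G) - d)"
      using assms(3)[OF that] by (intro sum_mono) simp
    finally show ?thesis using P[OF that] by simp
  qed
  then have "(\<Sum>i<r. \<Sum>x\<in>verts G. real (card (P i - neighbours G x))) \<le> (\<Sum>i<r. T * (card (verts G) - d))"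
    by (intro sum_mono) simp
  then show ?thesis by (subst sum.swap) (simp add: algebra_simps)
qed

lemma not_rich_vertE:
  assumes "sgraph G" "blowup_parts G r T P" "x \<in> verts G - rich_verts G r t P"
  obtains i where "i < r" "real T - t \<le> card (P i - neighbours G x)"
proof -
  obtain i where i: "i < r" "card (neighbours G x \<inter> P i) < t"
    using assms(3) by (auto simp: rich_verts_def not_le)
  then have "finite (P i)" "card (P i) = T"
    using finite_blowup_part[OF assms(1,2)] assms(2) by (auto simp: blowup_parts_def)
  then have "T = card (P i - neighbours G x) + card (neighbours G x \<inter> P i)"
    using card_Diff_subset_Int[of "P i" "neighbours G x"] card_mono[of "P i" "neighbours G x \<inter> P i"]
    by (simp add: Int_commute)
  then show thesis using i that[of i] by simp
qed

subsection \<open>Large and near-extremal graphs\<close>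

definition large_graphs :: "'a graph filter" where
  "large_graphs = inf (filtercomap (\<lambda>G. card (verts G)) sequentially) (principal {G. sgraph G})"

definition turan_density :: "nat \<Rightarrow> real" where
  "turan_density r = 1 - 1 / real r"

text \<open>Graphs without \<open>K\<^bsub>r+1\<^esub>(t)\<close> whose order tends to infinity and whose edge density is at least
  \<open>1 - 1/r - o(1)\<close>.\<close>

definition near_extremal :: "nat \<Rightarrow> nat \<Rightarrow> 'a graph filter" where
  "near_extremal r t = (INF \<eta>\<in>{0<..}. inf large_graphs
     (principal {G. turan_density r - \<eta> \<le> edge_density G \<and> \<not> has_blowup G (Suc r) t}))"

lemma eventually_large_graphs:
  "eventually P large_graphs \<longleftrightarrow> (\<exists>N. \<forall>G. sgraph G \<longrightarrow> N \<le> card (verts G) \<longrightarrow> P G)"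
  unfolding large_graphs_def eventually_inf_principal eventually_filtercomap_at_top_linorder by auto

lemma eventually_sgraph: "\<forall>\<^sub>F G in large_graphs. sgraph G"
  by (simp add: eventually_large_graphs)

lemma eventually_le_card_verts:
  fixes c :: real
  assumes "0 < c"
  shows "\<forall>\<^sub>F G in large_graphs. x \<le> c * card (verts G)"
  unfolding eventually_large_graphs
proof (intro exI allI impI)
  fix G :: "'a graph" assume "nat \<lceil>x / c\<rceil> \<le> card (verts G)"
  then have "x / c \<le> card (verts G)" by linarith
  then show "x \<le> c * card (verts G)" using assms by (simp add: field_simps)
qed

lemma eventually_large_induced:
  fixes c :: real
  assumes "\<forall>\<^sub>F H in large_graphs. Q H" "0 < c"
  shows "\<forall>\<^sub>F G in large_graphs. \<forall>S\<subseteq>verts G. c * card (verts G) \<le> card S \<longrightarrow> Q (induced G S)"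
proof -
  obtain N where N: "\<And>H. sgraph H \<Longrightarrow> N \<le> card (verts H) \<Longrightarrow> Q H"
    using assms(1) unfolding eventually_large_graphs by blast
  have "\<forall>\<^sub>F G in large_graphs. real N \<le> c * card (verts G)"
    by (rule eventually_le_card_verts[OF assms(2)])
  then show ?thesis using eventually_sgraph
  proof eventually_elim
    case (elim G)
    then show ?case by (auto intro!: N sgraph_induced)
  qed
qed

lemma eventually_near_extremal:
  "eventually P (near_extremal r t) \<longleftrightarrow> (\<exists>\<eta>>0. \<forall>\<^sub>F G in large_graphs.
     turan_density r - \<eta> \<le> edge_density G \<longrightarrow> \<not> has_blowup G (Suc r) t \<longrightarrow> P G)"
proof -
  have "eventually P (near_extremal r t) \<longleftrightarrow> (\<exists>\<eta>\<in>{0<..}. eventually P (inf large_graphs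
      (principal {G. turan_density r - \<eta> \<le> edge_density G \<and> \<not> has_blowup G (Suc r) t})))"
    unfolding near_extremal_def
  proof (rule eventually_INF_base)
    fix \<eta> \<eta>' :: real assume "\<eta> \<in> {0<..}" "\<eta>' \<in> {0<..}"
    then show "\<exists>\<zeta>\<in>{0<..}. inf large_graphs
          (principal {G. turan_density r - \<zeta> \<le> edge_density G \<and> \<not> has_blowup G (Suc r) t})
        \<le> inf (inf large_graphs
            (principal {G. turan_density r - \<eta> \<le> edge_density G \<and> \<not> has_blowup G (Suc r) t}))
          (inf large_graphs
            (principal {G. turan_density r - \<eta>' \<le> edge_density G \<and> \<not> has_blowup G (Suc r) t}))"
      by (intro bexI[of _ "min \<eta> \<eta>'"]) (auto intro!: le_infI2 simp: inf_assoc)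
  qed auto
  then show ?thesis by (simp add: eventually_inf_principal Bex_def imp_conjL)
qed

lemma eventually_near_extremal_if_large:
  "eventually P large_graphs \<Longrightarrow> eventually P (near_extremal r t)"
  unfolding eventually_near_extremal by (intro exI[of _ 1]) (auto elim: eventually_mono)

lemma eventually_no_blowup: "\<forall>\<^sub>F G in near_extremal r t. \<not> has_blowup G (Suc r) t"
  unfolding eventually_near_extremal by (intro exI[of _ 1]) auto

subsection \<open>The Erdos--Stone theorem\<close>

lemma card_rich_verts_ge:
  fixes d :: real
  assumes "sgraph G" "blowup_parts G r T P"
    and "\<And>i v. i < r \<Longrightarrow> v \<in> P i \<Longrightarrow> d * card (verts G) \<le> degree G v"
  shows "(T * (1 - r * (1 - d)) - t) * card (verts G) \<le> T * card (rich_verts G r t P)"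
proof -
  define n where "n = real (card (verts G))"
  define U where "U = rich_verts G r t P"
  have U: "U \<subseteq> verts G" by (auto simp: U_def rich_verts_def)
  have poor: "real T - t \<le> (\<Sum>i<r. real (card (P i - neighbours G x)))" if x: "x \<in> verts G - U" for x
  proof -
    obtain i where "i < r" "real T - t \<le> card (P i - neighbours G x)"
      using not_rich_vertE[OF assms(1,2)] x unfolding U_def .
    then show ?thesis
      using member_le_sum[of i "{..<r}" "\<lambda>i. real (card (P i - neighbours G x))"] by simp
  qed
  have "(n - card U) * (real T - t) = card (verts G - U) * (real T - t)"
    by (simp add: n_def card_verts_Diff[OF assms(1) U])
  also have "\<dots> \<le> (\<Sum>x\<in>verts G - U. \<Sum>i<r. real (card (P i - neighbours G x)))"
    by (rule sum_bounded_below[OF poor])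
  also have "\<dots> \<le> (\<Sum>x\<in>verts G. \<Sum>i<r. real (card (P i - neighbours G x)))"
    using assms(1) by (intro sum_mono2 sum_nonneg) auto
  also have "\<dots> \<le> real r * T * (n - d * n)"
    unfolding n_def by (rule sum_non_neighbours_blowup_parts_le[OF assms])
  finally have "(T * (1 - r * (1 - d)) - t) * n + card U * real t \<le> T * card U"
    by (simp add: algebra_simps)
  moreover have "0 \<le> card U * real t" by simp
  ultimately show ?thesis unfolding n_def U_def by linarith
qed

lemma blowup_parts_extend:
  fixes d :: real
  assumes "r * (1 - d) < 1"
  obtains T where "\<forall>\<^sub>F G in large_graphs. \<forall>P. blowup_parts G r T P \<longrightarrow>
    (\<forall>i<r. \<forall>v\<in>P i. d * card (verts G) \<le> degree G v) \<longrightarrow> has_blowup G (Suc r) t"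
proof -
  define \<kappa> where "\<kappa> = 1 - r * (1 - d)"
  have "0 < \<kappa>" using assms by (simp add: \<kappa>_def)
  obtain T :: nat where "2 * t / \<kappa> + 1 < real T" using reals_Archimedean2 by blast
  moreover have "0 \<le> 2 * t / \<kappa>" using \<open>0 < \<kappa>\<close> by simp
  ultimately have "0 < T" "2 * t / \<kappa> \<le> T" by linarith+
  then have T: "0 < T" "2 * t \<le> \<kappa> * T" using \<open>0 < \<kappa>\<close> by (simp_all add: field_simps)
  have "\<forall>\<^sub>F G in large_graphs. real (t * 2 ^ (r * T)) + 1 \<le> \<kappa> / 2 * card (verts G)"
    by (rule eventually_le_card_verts) (use \<open>0 < \<kappa>\<close> in simp)
  then have "\<forall>\<^sub>F G in large_graphs. \<forall>P. blowup_parts G r T P \<longrightarrow>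
    (\<forall>i<r. \<forall>v\<in>P i. d * card (verts G) \<le> degree G v) \<longrightarrow> has_blowup G (Suc r) t"
    using eventually_sgraph
  proof eventually_elim
    case (elim G)
    show ?case
    proof (intro allI impI)
      fix P assume P: "blowup_parts G r T P" and "\<forall>i<r. \<forall>v\<in>P i. d * card (verts G) \<le> degree G v"
      then have rich: "(T * \<kappa> - t) * card (verts G) \<le> T * card (rich_verts G r t P)"
        using card_rich_verts_ge[OF elim(2) P] unfolding \<kappa>_def by blast
      have "T * (\<kappa> / 2 * card (verts G)) \<le> (T * \<kappa> - t) * card (verts G)"
        using mult_right_mono[of "T * \<kappa> / 2" "T * \<kappa> - t" "real (card (verts G))"] T(2)
        by (simp add: algebra_simps)
      also note rich
      finally have "\<kappa> / 2 * card (verts G) \<le> card (rich_verts G r t P)" using T(1) by simp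
      then have "t * 2 ^ (r * T) < card (rich_verts G r t P)" using elim(1) by linarith
      then show "has_blowup G (Suc r) t" by (rule has_blowup_Suc_if_many_rich_verts[OF elim(2) P])
    qed
  qed
  then show thesis by (rule that)
qed

lemma Erdos_Stone_min_degree:
  fixes d :: real
  assumes "r * (1 - d) < 1"
  shows "\<forall>\<^sub>F G :: 'a graph in large_graphs.
    (\<forall>v\<in>verts G. d * card (verts G) \<le> degree G v) \<longrightarrow> has_blowup G (Suc r) t"
  using assms
proof (induction r arbitrary: t)
  case 0
  obtain T where "\<forall>\<^sub>F G :: 'a graph in large_graphs. \<forall>P. blowup_parts G 0 T P \<longrightarrow>
      (\<forall>i<0. \<forall>v\<in>P i. d * card (verts G) \<le> degree G v) \<longrightarrow> has_blowup G (Suc 0) t"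
    by (rule blowup_parts_extend[OF 0])
  then show ?case by eventually_elim (simp add: blowup_parts_def)
next
  case (Suc r)
  have "r * (1 - d) < 1"
  proof (cases "d \<le> 1")
    case True
    then have "r * (1 - d) \<le> Suc r * (1 - d)" by (intro mult_right_mono) auto
    then show ?thesis using Suc.prems by linarith
  next
    case False
    then have "r * (1 - d) \<le> 0" by (simp add: mult_nonneg_nonpos)
    then show ?thesis by linarith
  qed
  obtain T where "\<forall>\<^sub>F G :: 'a graph in large_graphs. \<forall>P. blowup_parts G (Suc r) T P \<longrightarrow>
      (\<forall>i<Suc r. \<forall>v\<in>P i. d * card (verts G) \<le> degree G v) \<longrightarrow> has_blowup G (Suc (Suc r)) t"
    by (rule blowup_parts_extend[OF Suc.prems])
  with Suc.IH[OF \<open>r * (1 - d) < 1\<close>, of T] show ?case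
  proof eventually_elim
    case (elim G)
    have "P i \<subseteq> verts G" if "blowup_parts G (Suc r) T P" "i < Suc r" for P i
      using that by (simp add: blowup_parts_def)
    then show ?case using elim unfolding has_blowup_def[of G "Suc r"] by (meson subsetD)
  qed
qed

lemma dense_induced_subgraph:
  fixes c \<epsilon> :: real
  assumes G: "sgraph G" and c: "0 \<le> c" and dense: "c + \<epsilon> \<le> edge_density G"
  obtains S where "S \<subseteq> verts G" "sqrt \<epsilon> * card (verts G) \<le> card S"
    "\<And>v. v \<in> S \<Longrightarrow> c * card S - c / 2 \<le> degree (induced G S) v"
proof -
  define deficit where "deficit S = c * real (card S) ^ 2 / 2 - card (edges (induced G S))" for S
  define S where "S = arg_min_on deficit (Pow (verts G))"
  have fin: "finite (Pow (verts G))" using G by simp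
  have S: "S \<subseteq> verts G" using arg_min_if_finite(1)[OF fin, of deficit] by (auto simp: S_def)
  have least: "deficit S \<le> deficit S'" if "S' \<subseteq> verts G" for S'
    unfolding S_def using that by (intro arg_min_least[OF fin]) auto
  have sS: "sgraph (induced G S)" by (rule sgraph_induced[OF G S])
  have "edges (induced G (verts G)) = edges G" using edge_subset_verts[OF G] by auto
  then have "deficit (verts G) = (c - edge_density G) * real (card (verts G)) ^ 2 / 2"
    using double_card_edges[OF G] by (simp add: deficit_def algebra_simps)
  also have "\<dots> \<le> - \<epsilon> * real (card (verts G)) ^ 2 / 2"
    using dense by (intro divide_right_mono mult_right_mono) auto
  finally have "\<epsilon> * real (card (verts G)) ^ 2 \<le> 2 * card (edges (induced G S)) - c * real (card S) ^ 2"
    using least[OF subset_refl] by (simp add: deficit_def)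
  also have "\<dots> \<le> (edge_density (induced G S) - c) * real (card S) ^ 2"
    using double_card_edges[OF sS] by (simp add: algebra_simps)
  also have "\<dots> \<le> 1 * real (card S) ^ 2"
    using edge_density_le_one[OF sS] c by (intro mult_right_mono) auto
  finally have "sqrt \<epsilon> * card (verts G) \<le> card S"
    using real_sqrt_le_mono[of "\<epsilon> * real (card (verts G)) ^ 2" "real (card S) ^ 2"]
    by (simp add: real_sqrt_mult)
  moreover have "c * card S - c / 2 \<le> degree (induced G S) v" if v: "v \<in> S" for v
  proof -
    have "card (edges (induced G S)) \<le> card (edges (induced G (S - {v}))) + degree (induced G S) v"
      using card_edges_le_del_verts[OF sS, of "{v}"]
      by (simp add: induced_induced del: edges_induced)
    moreover have "deficit S \<le> deficit (S - {v})" using S by (intro least) auto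
    moreover have "real (card (S - {v})) = real (card S) - 1"
      using v sS card_Suc_Diff1[of S v] finite_verts[OF sS] by (simp add: of_nat_diff)
    ultimately have "c * real (card S) ^ 2 / 2 - c * (real (card S) - 1) ^ 2 / 2 \<le> degree (induced G S) v"
      by (simp add: deficit_def)
    then show ?thesis by (simp add: power2_eq_square algebra_simps diff_divide_distrib add_divide_distrib)
  qed
  ultimately show thesis using S that by blast
qed

lemma turan_density_nonneg: "0 < r \<Longrightarrow> 0 \<le> turan_density r"
  by (simp add: turan_density_def)

lemma turan_density_le_one: "turan_density r \<le> 1"
  by (simp add: turan_density_def)

theorem Erdos_Stone:
  assumes "0 < r" "turan_density r < c"
  shows "\<forall>\<^sub>F G :: 'a graph in large_graphs. c \<le> edge_density G \<longrightarrow> has_blowup G (Suc r) t"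
proof -
  define \<epsilon> where "\<epsilon> = (c - turan_density r) / 3"
  define d where "d = turan_density r + \<epsilon>"
  have "0 < \<epsilon>" using assms(2) by (simp add: \<epsilon>_def)
  have "0 \<le> d" using turan_density_nonneg[OF assms(1)] \<open>0 < \<epsilon>\<close> by (simp add: d_def)
  have "r * (1 - d) < 1"
    using assms(1) \<open>0 < \<epsilon>\<close> by (simp add: d_def turan_density_def field_simps)
  have "\<forall>\<^sub>F H in large_graphs. (d + \<epsilon>) / 2 \<le> \<epsilon> * card (verts H)"
    by (rule eventually_le_card_verts[OF \<open>0 < \<epsilon>\<close>])
  with Erdos_Stone_min_degree[OF \<open>r * (1 - d) < 1\<close>, of t]
  have "\<forall>\<^sub>F H in large_graphs. (\<forall>v\<in>verts H. (d + \<epsilon>) * card (verts H) - (d + \<epsilon>) / 2 \<le> degree H v)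
      \<longrightarrow> has_blowup H (Suc r) t"
  proof eventually_elim
    case (elim H)
    have "d * card (verts H) \<le> (d + \<epsilon>) * card (verts H) - (d + \<epsilon>) / 2"
      using elim(2) by (simp add: algebra_simps)
    then show ?case using elim(1) by (meson order_trans)
  qed
  then have "\<forall>\<^sub>F G :: 'a graph in large_graphs. \<forall>S\<subseteq>verts G. sqrt \<epsilon> * card (verts G) \<le> card S \<longrightarrow>
      (\<forall>v\<in>verts (induced G S). (d + \<epsilon>) * card (verts (induced G S)) - (d + \<epsilon>) / 2
        \<le> degree (induced G S) v) \<longrightarrow> has_blowup (induced G S) (Suc r) t"
    by (rule eventually_large_induced) (use \<open>0 < \<epsilon>\<close> in simp)
  then show ?thesis using eventually_sgraph
  proof eventually_elim
    case (elim G)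
    show ?case
    proof
      assume "c \<le> edge_density G"
      then have "(d + \<epsilon>) + \<epsilon> \<le> edge_density G" by (simp add: d_def \<epsilon>_def field_simps)
      then obtain S where S: "S \<subseteq> verts G" "sqrt \<epsilon> * card (verts G) \<le> card S"
        "\<And>v. v \<in> S \<Longrightarrow> (d + \<epsilon>) * card S - (d + \<epsilon>) / 2 \<le> degree (induced G S) v"
        using dense_induced_subgraph[OF elim(2)] \<open>0 \<le> d\<close> \<open>0 < \<epsilon>\<close>
        by (metis add_nonneg_nonneg less_imp_le)
      then have "has_blowup (induced G S) (Suc r) t" using elim(1) by auto
      then show "has_blowup G (Suc r) t" by (rule has_blowup_induced[OF S(1)])
    qed
  qed
qed

subsection \<open>Degrees in near-extremal graphs\<close>

lemma edge_density_del_low_degree_verts: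
  fixes p \<epsilon> :: real
  assumes G: "sgraph G" and X: "X \<subseteq> verts G" "\<And>v. v \<in> X \<Longrightarrow> degree G v \<le> (p - \<epsilon>) * card (verts G)"
    and cX: "\<epsilon> * card (verts G) \<le> card X" "card X \<le> \<epsilon> * card (verts G) + 1" "card X < card (verts G)"
    and large: "2 \<le> \<epsilon> * card (verts G)" and p: "0 \<le> p" "p \<le> 1"
    and dense: "p - \<epsilon> ^ 2 / 4 \<le> edge_density G"
  shows "p + \<epsilon> ^ 2 / 4 \<le> edge_density (del_verts G X)"
proof -
  define n where "n = real (card (verts G))"
  define l where "l = real (card X)"
  define \<eta> where "\<eta> = \<epsilon> ^ 2 / 4"
  have "finite X" using X(1) G by (auto intro: finite_subset)
  have cS: "real (card (verts G - X)) = n - l"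
    by (simp add: n_def l_def card_verts_Diff[OF G X(1)])
  have "(\<Sum>v\<in>X. real (degree G v)) \<le> l * ((p - \<epsilon>) * n)"
    using sum_bounded_above[of X "\<lambda>v. real (degree G v)"] X(2) by (simp add: l_def n_def)
  then have "(p - \<eta>) * n ^ 2 - 2 * (l * ((p - \<epsilon>) * n))
      \<le> 2 * real (card (edges G)) - 2 * (\<Sum>v\<in>X. real (degree G v))"
    using double_card_edges[OF G] mult_right_mono[OF dense, of "n ^ 2"] by (simp add: n_def \<eta>_def)
  also have "\<dots> \<le> 2 * card (edges (del_verts G X))"
    using of_nat_mono[OF card_edges_le_del_verts[OF G \<open>finite X\<close>], where 'a = real] by simp
  also have "\<dots> = edge_density (del_verts G X) * (n - l) ^ 2"
    using double_card_edges[OF sgraph_induced[OF G, of "verts G - X"]] cS by auto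
  finally have lower: "(p - \<eta>) * n ^ 2 - 2 * (l * ((p - \<epsilon>) * n))
      \<le> edge_density (del_verts G X) * (n - l) ^ 2" .
  have "2 * (\<eta> * n ^ 2) = (\<epsilon> * n) * (\<epsilon> * n / 2)" by (simp add: \<eta>_def power2_eq_square)
  also have "\<dots> \<le> l * (2 * (\<epsilon> * n) - l)"
    using cX(1,2) large by (intro mult_mono) (auto simp: n_def l_def)
  finally have gain: "l * l + 2 * (\<eta> * n ^ 2) \<le> 2 * (l * (\<epsilon> * n))" by (simp add: algebra_simps)
  have "(p + \<eta>) * (n - l) ^ 2 = p * n ^ 2 - 2 * (l * (p * n)) + p * l ^ 2 + \<eta> * (n - l) ^ 2"
    by (simp add: power2_eq_square algebra_simps)
  also have "p * l ^ 2 \<le> l * l" using p by (simp add: power2_eq_square mult_left_le_one_le)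
  also have "\<eta> * (n - l) ^ 2 \<le> \<eta> * n ^ 2"
    using cX(3) by (intro mult_left_mono power_mono) (auto simp: n_def l_def \<eta>_def)
  also have "p * n ^ 2 - 2 * (l * (p * n)) + l * l + \<eta> * n ^ 2
      \<le> (p - \<eta>) * n ^ 2 - 2 * (l * ((p - \<epsilon>) * n))"
    using gain by (simp add: algebra_simps)
  finally have "(p + \<eta>) * (n - l) ^ 2 \<le> (p - \<eta>) * n ^ 2 - 2 * (l * ((p - \<epsilon>) * n))" by simp
  then have "(p + \<eta>) * (n - l) ^ 2 \<le> edge_density (del_verts G X) * (n - l) ^ 2"
    using lower by linarith
  moreover have "0 < (n - l) ^ 2" using cX(3) by (simp add: n_def l_def)
  ultimately show ?thesis by (simp add: \<eta>_def)
qed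

lemma ex_denser_del_verts:
  fixes p \<epsilon> :: real
  assumes G: "sgraph G" and p: "0 \<le> p" "p \<le> 1" and \<epsilon>: "\<epsilon> \<le> 1 / 2" "2 \<le> \<epsilon> * card (verts G)"
    and dense: "p - \<epsilon> ^ 2 / 4 \<le> edge_density G"
    and few: "card (high_degree_verts G ((p - \<epsilon>) * card (verts G))) < (1 - \<epsilon>) * card (verts G)"
  shows "\<exists>X\<subseteq>verts G. 1 / 4 * card (verts G) \<le> card (verts G - X) \<and>
    p + \<epsilon> ^ 2 / 4 \<le> edge_density (del_verts G X)"
proof -
  define n where "n = real (card (verts G))"
  define U where "U = high_degree_verts G ((p - \<epsilon>) * n)"
  have "\<epsilon> * n \<le> 1 / 2 * n" using \<epsilon>(1) by (intro mult_right_mono) (auto simp: n_def)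
  have "\<epsilon> * n < n - card U" using few by (simp add: n_def U_def algebra_simps)
  also have "\<dots> = card (verts G - U)"
    using G by (simp add: n_def card_verts_Diff U_def high_degree_verts_subset)
  finally have "nat \<lceil>\<epsilon> * n\<rceil> \<le> card (verts G - U)" by linarith
  then obtain X where X: "X \<subseteq> verts G - U" "card X = nat \<lceil>\<epsilon> * n\<rceil>"
    by (meson obtain_subset_with_card_n)
  then have XV: "X \<subseteq> verts G" by blast
  have cX: "\<epsilon> * n \<le> card X" "card X \<le> \<epsilon> * n + 1" "card X < n"
    using X(2) \<epsilon>(2) \<open>\<epsilon> * n \<le> 1 / 2 * n\<close> unfolding n_def by linarith+
  have "degree G v \<le> (p - \<epsilon>) * n" if "v \<in> X" for v
    using X(1) that by (auto simp: U_def high_degree_verts_def)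
  then have "p + \<epsilon> ^ 2 / 4 \<le> edge_density (del_verts G X)"
    using cX \<epsilon>(2) p dense by (intro edge_density_del_low_degree_verts[OF G XV]) (auto simp: n_def)
  moreover have "1 / 4 * n \<le> card (verts G - X)"
    using cX(2) \<epsilon>(2) \<open>\<epsilon> * n \<le> 1 / 2 * n\<close> by (simp add: n_def card_verts_Diff[OF G XV])
  ultimately show ?thesis using XV by (auto simp: n_def)
qed

lemma many_high_degree_verts:
  fixes \<epsilon> :: real
  assumes "0 < r" "0 < \<epsilon>" "\<epsilon> \<le> 1 / 2"
  shows "\<forall>\<^sub>F G in near_extremal r t. (1 - \<epsilon>) * card (verts G)
    \<le> card (high_degree_verts G ((turan_density r - \<epsilon>) * card (verts G)))"
  unfolding eventually_near_extremal
proof (intro exI conjI)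
  show "0 < \<epsilon> ^ 2 / 4" using assms(2) by simp
  have "\<forall>\<^sub>F G in large_graphs. \<forall>S\<subseteq>verts G. 1 / 4 * card (verts G) \<le> card S \<longrightarrow>
      turan_density r + \<epsilon> ^ 2 / 4 \<le> edge_density (induced G S) \<longrightarrow> has_blowup (induced G S) (Suc r) t"
    using Erdos_Stone[OF assms(1), of "turan_density r + \<epsilon> ^ 2 / 4" t] assms(2)
    by (intro eventually_large_induced) auto
  moreover have "\<forall>\<^sub>F G in large_graphs. 2 \<le> \<epsilon> * card (verts G)"
    by (rule eventually_le_card_verts[OF assms(2)])
  ultimately show "\<forall>\<^sub>F G in large_graphs.
      turan_density r - \<epsilon> ^ 2 / 4 \<le> edge_density G \<longrightarrow> \<not> has_blowup G (Suc r) t \<longrightarrow>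
      (1 - \<epsilon>) * card (verts G) \<le> card (high_degree_verts G ((turan_density r - \<epsilon>) * card (verts G)))"
    using eventually_sgraph
  proof eventually_elim
    case (elim G)
    show ?case
    proof (rule impI, rule impI, rule ccontr)
      assume "turan_density r - \<epsilon> ^ 2 / 4 \<le> edge_density G" and free: "\<not> has_blowup G (Suc r) t"
        and "\<not> (1 - \<epsilon>) * card (verts G)
          \<le> card (high_degree_verts G ((turan_density r - \<epsilon>) * card (verts G)))"
      then obtain X where "1 / 4 * card (verts G) \<le> card (verts G - X)"
        "turan_density r + \<epsilon> ^ 2 / 4 \<le> edge_density (del_verts G X)"
        using ex_denser_del_verts[OF elim(3) turan_density_nonneg[OF assms(1)] turan_density_le_one
            assms(3) elim(2)] by (auto simp: not_le)
      then have "has_blowup (del_verts G X) (Suc r) t" using elim(1) by simp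
      then show False using free has_blowup_induced[of "verts G - X" G] by blast
    qed
  qed
qed

lemma card_Int_ge:
  assumes "finite V" "A \<subseteq> V" "B \<subseteq> V"
  shows "card A + card B \<le> card (A \<inter> B) + card V"
proof -
  have "card A + card B = card (A \<union> B) + card (A \<inter> B)"
    using assms by (intro card_Un_Int) (auto intro: finite_subset)
  moreover have "card (A \<union> B) \<le> card V" using assms by (intro card_mono) auto
  ultimately show ?thesis by simp
qed

lemma min_degree_constants:
  fixes p \<delta> :: real
  assumes "0 < r" "p = turan_density r" "0 < \<delta>"
  obtains \<epsilon> d where "0 < \<epsilon>" "\<epsilon> \<le> 1 / 2" "0 < p + \<delta> - \<epsilon>"
    "d \<le> 1" "real (r - 1) * (1 - d) < 1"
    "1 - p + \<epsilon> = (1 - d) * (p + \<delta> - \<epsilon>)"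
proof
  define \<epsilon> where "\<epsilon> = min (1 / 2) (\<delta> / (2 * r))"
  define d where "d = 1 - (1 - p + \<epsilon>) / (p + \<delta> - \<epsilon>)"
  show "0 < \<epsilon>" "\<epsilon> \<le> 1 / 2" using assms by (auto simp: \<epsilon>_def)
  have "r * \<epsilon> < \<delta>" using assms by (auto simp: \<epsilon>_def min_def field_simps)
  moreover have "1 * \<epsilon> \<le> r * \<epsilon>" using assms(1) \<open>0 < \<epsilon>\<close> by (intro mult_right_mono) auto
  moreover have "0 \<le> p" using assms(1,2) turan_density_nonneg by simp
  ultimately show pos: "0 < p + \<delta> - \<epsilon>" by linarith
  have "real (r - 1) * (1 - p) = p"
    using assms(1,2) by (simp add: turan_density_def of_nat_diff field_simps)
  then have "real (r - 1) * (1 - p + \<epsilon>) < p + \<delta> - \<epsilon>"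
    using \<open>r * \<epsilon> < \<delta>\<close> assms(1) by (simp add: of_nat_diff algebra_simps)
  then show "real (r - 1) * (1 - d) < 1" using pos by (simp add: d_def field_simps)
  have "0 < 1 - p + \<epsilon>" using \<open>0 < \<epsilon>\<close> turan_density_le_one[of r] assms(2) by simp
  then show "d \<le> 1" using pos by (simp add: d_def)
  show "1 - p + \<epsilon> = (1 - d) * (p + \<delta> - \<epsilon>)" using pos by (simp add: d_def)
qed

lemma has_blowup_in_large_set:
  fixes \<delta> :: real
  assumes "0 < r" "0 < \<delta>"
  shows "\<forall>\<^sub>F G in near_extremal r k. \<forall>R\<subseteq>verts G.
    (turan_density r + \<delta>) * card (verts G) \<le> card R \<longrightarrow> has_blowup (induced G R) r t"
proof -
  define p where "p = turan_density r"
  obtain \<epsilon> d where \<epsilon>: "0 < \<epsilon>" "\<epsilon> \<le> 1 / 2" "0 < p + \<delta> - \<epsilon>"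
    and d: "d \<le> 1" "real (r - 1) * (1 - d) < 1" "1 - p + \<epsilon> = (1 - d) * (p + \<delta> - \<epsilon>)"
    by (rule min_degree_constants[OF assms(1) p_def assms(2)])
  have "\<forall>\<^sub>F G in large_graphs. \<forall>S\<subseteq>verts G. (p + \<delta> - \<epsilon>) * card (verts G) \<le> card S \<longrightarrow>
      (\<forall>v\<in>verts (induced G S). d * card (verts (induced G S)) \<le> degree (induced G S) v) \<longrightarrow>
      has_blowup (induced G S) (Suc (r - 1)) t"
    by (rule eventually_large_induced[OF Erdos_Stone_min_degree[OF d(2)] \<epsilon>(3)])
  from many_high_degree_verts[OF assms(1) \<epsilon>(1,2), of k]
    eventually_near_extremal_if_large[OF this] eventually_near_extremal_if_large[OF eventually_sgraph]
  show ?thesis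
  proof eventually_elim
    case (elim G)
    define n where "n = real (card (verts G))"
    define U where "U = high_degree_verts G ((p - \<epsilon>) * n)"
    show ?case
    proof (intro allI impI)
      fix R assume R: "R \<subseteq> verts G" "(turan_density r + \<delta>) * card (verts G) \<le> card R"
      then have S: "R \<inter> U \<subseteq> verts G" by blast
      have "card R + card U \<le> card (R \<inter> U) + card (verts G)"
        using elim(3) R(1) high_degree_verts_subset unfolding U_def by (intro card_Int_ge) simp_all
      then have m: "(p + \<delta> - \<epsilon>) * n \<le> card (R \<inter> U)"
        using R(2) elim(1) by (simp add: p_def n_def U_def algebra_simps)
      have "d * card (R \<inter> U) \<le> degree (induced G (R \<inter> U)) v" if v: "v \<in> R \<inter> U" for v
      proof -
        have "(1 - p + \<epsilon>) * n = (1 - d) * ((p + \<delta> - \<epsilon>) * n)" using d(3) by simp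
        also have "\<dots> \<le> (1 - d) * card (R \<inter> U)" using m d(1) by (intro mult_left_mono) auto
        finally have "d * card (R \<inter> U) \<le> (p - \<epsilon>) * n + card (R \<inter> U) - n"
          by (simp add: algebra_simps)
        also have "\<dots> \<le> degree (induced G (R \<inter> U)) v"
          using degree_induced_ge[OF elim(3) S v] v by (simp add: U_def high_degree_verts_def n_def)
        finally show ?thesis .
      qed
      then have "has_blowup (induced G (R \<inter> U)) r t" using elim(2) S m assms(1) by (simp add: n_def)
      then show "has_blowup (induced G R) r t" by (rule has_blowup_induced_mono[rotated]) blast
    qed
  qed
qed

subsection \<open>Sets of vertices with a large common neighbourhood\<close>

lemma ex_small_fibre:
  assumes "finite A" "f ` A \<subseteq> {..<r}" "0 < r"
  shows "\<exists>j<r. r * card {x \<in> A. f x = j} \<le> card A"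
proof (rule ccontr)
  assume "\<not> ?thesis"
  then have "(\<Sum>j<r. card A) < (\<Sum>j<r. r * card {x \<in> A. f x = j})"
    using assms(3) by (intro sum_strict_mono) (auto simp: not_le)
  also have "\<dots> = r * card A"
    using sum.group[OF assms(1) finite_lessThan assms(2), where h = "\<lambda>_. 1 :: nat"]
    by (simp flip: sum_distrib_left)
  finally show False by simp
qed

lemma obtain_subset_small_values:
  fixes f :: "'a \<Rightarrow> real" and b :: real
  assumes "finite A" "\<And>x. x \<in> A \<Longrightarrow> 0 \<le> f x" "sum f A \<le> card A * b" "2 * k \<le> card A"
  obtains S where "S \<subseteq> A" "card S = k" "\<And>x. x \<in> S \<Longrightarrow> f x \<le> 2 * b"
proof -
  define B where "B = {x \<in> A. 2 * b < f x}"
  have "B \<subseteq> A" "finite B" using assms(1) by (auto simp: B_def)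
  have "2 * card B \<le> card A"
  proof (rule ccontr)
    assume "\<not> 2 * card B \<le> card A"
    then have "0 < card A" "B \<noteq> {}" using \<open>B \<subseteq> A\<close> assms(1) card_mono[of A B] by auto
    have "0 \<le> card A * b" using assms(2,3) sum_nonneg[of A f] by fastforce
    then have "0 \<le> b" using \<open>0 < card A\<close> by (simp add: zero_le_mult_iff)
    then have "card A * b \<le> real (2 * card B) * b"
      using \<open>\<not> 2 * card B \<le> card A\<close> by (intro mult_right_mono) auto
    also have "\<dots> = (\<Sum>x\<in>B. 2 * b)" by simp
    also have "\<dots> < sum f B" using \<open>finite B\<close> \<open>B \<noteq> {}\<close> by (intro sum_strict_mono) (auto simp: B_def)
    also have "\<dots> \<le> sum f A" using assms(1,2) \<open>B \<subseteq> A\<close> by (intro sum_mono2) auto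
    finally show False using assms(3) by simp
  qed
  then have "k \<le> card (A - B)" using assms(4) \<open>B \<subseteq> A\<close> \<open>finite B\<close> by (simp add: card_Diff_subset)
  then obtain S where "S \<subseteq> A - B" "card S = k" by (meson obtain_subset_with_card_n)
  then show thesis using that[of S] by (force simp: B_def)
qed

lemma obtain_large_common_neighbours:
  fixes b :: real
  assumes "sgraph G" "finite A" "W \<subseteq> verts G" "2 * k \<le> card A"
    and "(\<Sum>x\<in>W. real (card (A - neighbours G x))) \<le> card A * b"
  obtains S where "S \<subseteq> A" "card S = k" "card W - k * (2 * b) \<le> card (common_neighbours G S)"
proof -
  have "finite W" using assms(1,3) by (auto intro: finite_subset)
  then have few: "(\<Sum>s\<in>A. real (card (W - neighbours G s))) \<le> card A * b"
    using assms(5) sum_card_non_neighbours_swap[OF assms(2), of W G] by (metis of_nat_sum)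
  obtain S where S: "S \<subseteq> A" "card S = k" "\<And>s. s \<in> S \<Longrightarrow> real (card (W - neighbours G s)) \<le> 2 * b"
    using obtain_subset_small_values[OF assms(2) of_nat_0_le_iff few assms(4)] by blast
  have "finite S" using S(1) assms(2) by (rule finite_subset)
  have "W \<subseteq> common_neighbours G S \<union> (\<Union>s\<in>S. W - neighbours G s)"
  proof
    fix x assume "x \<in> W"
    then show "x \<in> common_neighbours G S \<union> (\<Union>s\<in>S. W - neighbours G s)"
      using assms(3) mem_neighbours_commute[of x G] by (auto simp: common_neighbours_def)
  qed
  then have "card W \<le> card (common_neighbours G S \<union> (\<Union>s\<in>S. W - neighbours G s))"
    using assms(1) \<open>finite S\<close> \<open>finite W\<close> by (intro card_mono) (auto simp: common_neighbours_def)
  also have "\<dots> \<le> card (common_neighbours G S) + card (\<Union>s\<in>S. W - neighbours G s)"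
    by (rule card_Un_le)
  also have "card (\<Union>s\<in>S. W - neighbours G s) \<le> (\<Sum>s\<in>S. card (W - neighbours G s))"
    using \<open>finite S\<close> by (rule card_UN_le)
  finally have "real (card W) \<le> card (common_neighbours G S) + (\<Sum>s\<in>S. real (card (W - neighbours G s)))"
    by (simp flip: of_nat_sum of_nat_add)
  also have "(\<Sum>s\<in>S. real (card (W - neighbours G s))) \<le> k * (2 * b)"
    using sum_bounded_above[of S "\<lambda>s. real (card (W - neighbours G s))" "2 * b"] S(2,3) by simp
  finally show thesis using that[OF S(1,2)] by simp
qed

text \<open>Almost every vertex misses almost all of some part. The degrees leave almost no room for
  further non-neighbours, so the vertices missing other parts see almost all of the part that is
  missed least often.\<close>

lemma obtain_rarely_missed_part:
  fixes \<beta> :: real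
  assumes G: "sgraph G" and parts: "blowup_parts G r T P" and "0 < r"
    and rich: "card (rich_verts G r k P) \<le> \<beta> * card (verts G)"
  obtains j W where "j < r" "W \<subseteq> verts G - rich_verts G r k P"
    "(turan_density r - \<beta>) * card (verts G) \<le> card W"
    "\<And>x. x \<in> W \<Longrightarrow> \<exists>i<r. i \<noteq> j \<and> real T - k \<le> card (P i - neighbours G x)"
proof -
  define n where "n = real (card (verts G))"
  define V where "V = verts G - rich_verts G r k P"
  have "rich_verts G r k P \<subseteq> verts G" by (auto simp: rich_verts_def)
  then have cV: "real (card V) = n - card (rich_verts G r k P)"
    using G by (simp add: n_def V_def card_verts_Diff)
  have "\<exists>i<r. real T - k \<le> card (P i - neighbours G x)" if "x \<in> V" for x
    using not_rich_vertE[OF G parts] that unfolding V_def by metis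
  then obtain f where f: "\<And>x. x \<in> V \<Longrightarrow> f x < r \<and> real T - k \<le> card (P (f x) - neighbours G x)"
    by metis
  have "finite V" using G by (simp add: V_def)
  then obtain j where "j < r" and j: "r * card {x \<in> V. f x = j} \<le> card V"
    using ex_small_fibre[of V f r] f \<open>0 < r\<close> by auto
  define W where "W = {x \<in> V. f x \<noteq> j}"
  have "real r * card {x \<in> V. f x = j} \<le> n" using of_nat_mono[OF j, where 'a = real] cV by simp
  then have "card {x \<in> V. f x = j} \<le> n / r" using \<open>0 < r\<close> by (simp add: field_simps)
  moreover have "card {x \<in> V. f x = j} + card W = card V"
    using \<open>finite V\<close>
    by (subst card_Un_disjoint[symmetric]) (auto simp: W_def intro: arg_cong[where f = card])
  moreover have "(turan_density r - \<beta>) * n = n - n / r - \<beta> * n"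
    by (simp add: turan_density_def algebra_simps)
  ultimately have "(turan_density r - \<beta>) * n \<le> card W" using cV rich unfolding n_def by linarith
  moreover have "\<exists>i<r. i \<noteq> j \<and> real T - k \<le> card (P i - neighbours G x)" if "x \<in> W" for x
    using f[of x] that by (auto simp: W_def)
  ultimately show thesis using \<open>j < r\<close> that[of j W] by (auto simp: W_def V_def n_def)
qed

lemma sum_non_neighbours_part_le:
  fixes \<beta> :: real
  assumes G: "sgraph G" and parts: "blowup_parts G r T P" and "0 < r" "j < r"
    and deg: "\<And>i v. i < r \<Longrightarrow> v \<in> P i \<Longrightarrow> (turan_density r - \<beta>) * card (verts G) \<le> degree G v"
    and W: "W \<subseteq> verts G - rich_verts G r k P"
      "\<And>x. x \<in> W \<Longrightarrow> \<exists>i<r. i \<noteq> j \<and> real T - k \<le> card (P i - neighbours G x)"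
  shows "(\<Sum>x\<in>W. real (card (P j - neighbours G x))) \<le>
    r * \<beta> * T * card (verts G) + card (rich_verts G r k P) * real T + k * real (card (verts G))"
proof -
  define n where "n = real (card (verts G))"
  define U where "U = rich_verts G r k P"
  define miss where "miss i x = real (card (P i - neighbours G x))" for i x
  have U: "U \<subseteq> verts G" by (auto simp: U_def rich_verts_def)
  then have cU: "real (card (verts G - U)) = n - card U"
    using G by (simp add: n_def card_verts_Diff)
  have "finite W" using W(1) G by (meson finite_Diff finite_subset finite_verts)
  then have "(n - card U) * (real T - k) + (\<Sum>x\<in>W. miss j x) =
      (\<Sum>x\<in>verts G - U. real T - k + (if x \<in> W then miss j x else 0))"
    using W(1) G cU by (simp add: U_def sum.distrib sum.If_cases Int_absorb1 flip: Int_def)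
  also have "\<dots> \<le> (\<Sum>x\<in>verts G - U. \<Sum>i<r. miss i x)"
  proof (rule sum_mono)
    fix x assume x: "x \<in> verts G - U"
    obtain i where i: "i < r" "real T - k \<le> miss i x" "x \<in> W \<longrightarrow> i \<noteq> j"
      using W(2)[of x] not_rich_vertE[OF G parts] x unfolding U_def miss_def by metis
    have "real T - k + (if x \<in> W then miss j x else 0) \<le> (\<Sum>i\<in>{i, j}. miss i x)"
      using i by (cases "i = j") (auto simp: miss_def)
    also have "\<dots> \<le> (\<Sum>i<r. miss i x)"
      using i(1) \<open>j < r\<close> by (intro sum_mono2) (auto simp: miss_def)
    finally show "real T - k + (if x \<in> W then miss j x else 0) \<le> (\<Sum>i<r. miss i x)" .
  qed
  also have "\<dots> \<le> (\<Sum>x\<in>verts G. \<Sum>i<r. miss i x)"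
    using G by (intro sum_mono2) (auto simp: miss_def intro: sum_nonneg)
  also have "\<dots> \<le> real r * T * (n - (turan_density r - \<beta>) * n)"
    unfolding n_def miss_def by (rule sum_non_neighbours_blowup_parts_le[OF G parts deg])
  also have "\<dots> = n * T + r * \<beta> * T * n"
    using \<open>0 < r\<close> by (simp add: turan_density_def field_simps)
  finally have "(\<Sum>x\<in>W. miss j x) + card U * real k \<le> r * \<beta> * T * n + card U * real T + k * n"
    by (simp add: algebra_simps)
  moreover have "0 \<le> card U * real k" by simp
  ultimately show ?thesis unfolding miss_def n_def U_def by linarith
qed

lemma obtain_common_neighbours_in_part:
  fixes \<beta> :: real
  assumes G: "sgraph G" and parts: "blowup_parts G r T P" and "0 < r"
    and deg: "\<And>i v. i < r \<Longrightarrow> v \<in> P i \<Longrightarrow> (turan_density r - \<beta>) * card (verts G) \<le> degree G v"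
    and rich: "card (rich_verts G r k P) \<le> \<beta> * card (verts G)" and T: "k \<le> \<beta> * T" "2 * k \<le> T"
  obtains S where "S \<subseteq> verts G" "card S = k"
    "(turan_density r - \<beta> * (1 + 2 * k * (real r + 2))) * card (verts G) \<le> card (common_neighbours G S)"
proof -
  define n where "n = real (card (verts G))"
  obtain j W where "j < r" and W: "W \<subseteq> verts G - rich_verts G r k P"
    "(turan_density r - \<beta>) * card (verts G) \<le> card W"
    "\<And>x. x \<in> W \<Longrightarrow> \<exists>i<r. i \<noteq> j \<and> real T - k \<le> card (P i - neighbours G x)"
    using obtain_rarely_missed_part[OF G parts \<open>0 < r\<close> rich] by blast
  have "(\<Sum>x\<in>W. real (card (P j - neighbours G x))) \<le>
      r * \<beta> * T * n + card (rich_verts G r k P) * real T + k * n"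
    unfolding n_def by (rule sum_non_neighbours_part_le[OF G parts \<open>0 < r\<close> \<open>j < r\<close> deg W(1,3)])
  also have "card (rich_verts G r k P) * real T \<le> (\<beta> * n) * T"
    using rich by (intro mult_right_mono) (simp_all add: n_def)
  also have "k * n \<le> (\<beta> * T) * n" using T(1) by (intro mult_right_mono) (simp_all add: n_def)
  finally have "(\<Sum>x\<in>W. real (card (P j - neighbours G x))) \<le> T * ((real r + 2) * \<beta> * n)"
    by (simp add: algebra_simps)
  moreover have Pj: "P j \<subseteq> verts G" "card (P j) = T"
    using parts \<open>j < r\<close> by (auto simp: blowup_parts_def)
  moreover have "W \<subseteq> verts G" using W(1) by blast
  ultimately obtain S where S: "S \<subseteq> P j" "card S = k"
    "card W - k * (2 * ((real r + 2) * \<beta> * n)) \<le> card (common_neighbours G S)"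
    using obtain_large_common_neighbours[OF G finite_blowup_part[OF G parts \<open>j < r\<close>]] T(2) by metis
  have "(turan_density r - \<beta> * (1 + 2 * k * (real r + 2))) * n \<le> card (common_neighbours G S)"
    using W(2) S(3) by (simp add: n_def algebra_simps)
  then show thesis using S(1,2) Pj(1) that[of S] by (auto simp: n_def)
qed

lemma high_degree_blowup_parts:
  fixes \<beta> :: real
  assumes "0 < r" "0 < \<beta>" "\<beta> \<le> 1 / (2 * real r)"
  shows "\<forall>\<^sub>F G in near_extremal r k. \<exists>P. blowup_parts G r T P \<and>
    (\<forall>i<r. \<forall>v\<in>P i. (turan_density r - \<beta>) * card (verts G) \<le> degree G v)"
proof -
  have r: "0 < 1 / (2 * real r)" "1 / (2 * real r) \<le> 1 / 2" using assms(1) by simp_all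
  then have "\<beta> \<le> 1 / 2" using assms(3) by linarith
  from many_high_degree_verts[OF assms(1,2) this, of k] has_blowup_in_large_set[OF assms(1) r(1), of T k]
  show ?thesis
  proof eventually_elim
    case (elim G)
    define n where "n = real (card (verts G))"
    define R where "R = high_degree_verts G ((turan_density r - \<beta>) * n)"
    have R: "R \<subseteq> verts G" by (simp add: R_def high_degree_verts_subset)
    have "(turan_density r + 1 / (2 * real r)) * n \<le> (1 - \<beta>) * n"
      using assms(3) by (intro mult_right_mono) (auto simp: turan_density_def n_def)
    also have "\<dots> \<le> card R" using elim(1) by (simp add: n_def R_def)
    finally have "has_blowup (induced G R) r T" using elim(2) R by (simp add: n_def)
    then obtain P where P: "blowup_parts (induced G R) r T P" by (auto simp: has_blowup_def)
    then have "(turan_density r - \<beta>) * n \<le> degree G v" if "i < r" "v \<in> P i" for i v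
      using that by (auto simp: blowup_parts_def R_def high_degree_verts_def)
    then show ?case using blowup_parts_induced[OF R P] by (auto simp: n_def)
  qed
qed

lemma large_common_neighbourhood:
  fixes \<epsilon> :: real
  assumes "0 < r" "0 < \<epsilon>"
  shows "\<forall>\<^sub>F G in near_extremal r k. \<exists>S\<subseteq>verts G. card S = k \<and>
    (turan_density r - \<epsilon>) * card (verts G) \<le> card (common_neighbours G S)"
proof -
  define D where "D = 1 + 2 * real k * (real r + 2)"
  define \<beta> where "\<beta> = min (1 / (2 * real r)) (\<epsilon> / D)"
  have "1 \<le> D" by (simp add: D_def)
  then have \<beta>: "0 < \<beta>" "\<beta> \<le> 1 / (2 * real r)" "\<beta> * D \<le> \<epsilon>"
    using assms by (auto simp: \<beta>_def min_def field_simps)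
  moreover have "1 / (2 * real r) \<le> 1 / 2" using assms(1) by simp
  ultimately have "\<beta> \<le> 1 / 2" by linarith
  obtain T :: nat where "real k / \<beta> < T" using reals_Archimedean2 by blast
  then have T: "k \<le> \<beta> * T" using \<beta>(1) by (simp add: field_simps)
  also have "\<dots> \<le> 1 / 2 * T" using \<open>\<beta> \<le> 1 / 2\<close> by (intro mult_right_mono) auto
  finally have "2 * k \<le> T" by linarith
  have "\<forall>\<^sub>F G in large_graphs. real (k * 2 ^ (r * T)) \<le> \<beta> * card (verts G)"
    by (rule eventually_le_card_verts[OF \<beta>(1)])
  from high_degree_blowup_parts[OF assms(1) \<beta>(1,2), of T k] eventually_no_blowup
    eventually_near_extremal_if_large[OF this] eventually_near_extremal_if_large[OF eventually_sgraph]
  show ?thesis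
  proof eventually_elim
    case (elim G)
    define n where "n = real (card (verts G))"
    obtain P where P: "blowup_parts G r T P"
      "\<And>i v. i < r \<Longrightarrow> v \<in> P i \<Longrightarrow> (turan_density r - \<beta>) * n \<le> degree G v"
      using elim(1) unfolding n_def by blast
    have "card (rich_verts G r k P) \<le> k * 2 ^ (r * T)"
      using has_blowup_Suc_if_many_rich_verts[OF elim(4) P(1)] elim(2) by (meson not_le)
    then have "card (rich_verts G r k P) \<le> \<beta> * n" using elim(3) unfolding n_def by linarith
    then obtain S where S: "S \<subseteq> verts G" "card S = k"
      "(turan_density r - \<beta> * D) * n \<le> card (common_neighbours G S)"
      using P(2) obtain_common_neighbours_in_part[OF elim(4) P(1) assms(1) _ _ T \<open>2 * k \<le> T\<close>]
      unfolding n_def D_def by metis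
    have "(turan_density r - \<epsilon>) * n \<le> (turan_density r - \<beta> * D) * n"
      using \<beta>(3) by (intro mult_right_mono) (auto simp: n_def)
    also note S(3)
    finally show ?case using S(1,2) by (auto simp: n_def)
  qed
qed

subsection \<open>Copies of a vertex-critical graph\<close>

lemma not_free_of_if_has_blowup:
  assumes F: "sgraph F" and G: "sgraph G" and "has_blowup G (chromatic_number F) (card (verts F))"
  shows "\<not> free_of F G"
proof -
  obtain c where c: "proper_coloring F (chromatic_number F) c"
    by (rule chromatic_number_coloring[OF F])
  obtain P where P: "blowup_parts G (chromatic_number F) (card (verts F)) P"
    using assms(3) by (auto simp: has_blowup_def)
  have c_less: "c x < chromatic_number F" if "x \<in> verts F" for x
    using c that by (auto simp: proper_coloring_def)
  have "\<exists>g. g ` verts F \<subseteq> P i \<and> inj_on g (verts F)" if "i < chromatic_number F" for i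
    using P that F finite_blowup_part[OF G P that]
    by (intro card_le_inj) (auto simp: blowup_parts_def)
  then obtain g where g: "\<And>i. i < chromatic_number F \<Longrightarrow> g i ` verts F \<subseteq> P i \<and> inj_on (g i) (verts F)"
    by metis
  define f where "f x = g (c x) x" for x
  have f: "f x \<in> P (c x)" if "x \<in> verts F" for x using g[OF c_less[OF that]] that by (auto simp: f_def)
  have adj: "f y \<in> neighbours G (f x)" if "x \<in> verts F" "y \<in> verts F" "c x \<noteq> c y" for x y
    using P c_less[OF that(1)] c_less[OF that(2)] that(3) f[OF that(1)] f[OF that(2)]
    unfolding blowup_parts_def by blast
  have "embeds_via f F G" unfolding embeds_via_def
  proof (intro conjI ballI)
    show "inj_on f (verts F)"
    proof (rule inj_onI)
      fix x y assume xy: "x \<in> verts F" "y \<in> verts F" "f x = f y"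
      then have "c x = c y" using adj[OF xy(1,2)] not_mem_neighbours_self[OF G] by metis
      then show "x = y" using g[OF c_less[OF xy(1)]] xy by (auto simp: f_def dest: inj_onD)
    qed
    show "f ` verts F \<subseteq> verts G" using f c_less P by (fastforce simp: blowup_parts_def)
    fix e assume "e \<in> edges F"
    then obtain x y where "e = {x, y}" "x \<in> verts F" "y \<in> verts F" by (rule edgeE[OF F])
    moreover from this have "c x \<noteq> c y" using c \<open>e \<in> edges F\<close> by (simp add: proper_coloring_def)
    ultimately show "f ` e \<in> edges G" using adj by (simp add: neighbours_def)
  qed
  then show ?thesis by (rule not_free_ofI[OF F])
qed

lemma sgraph_del_vert: "sgraph F \<Longrightarrow> sgraph (del_vert F u)"
  by (auto simp: sgraph_def del_vert_def)

lemma embeds_via_insert: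
  assumes F: "sgraph F" and G: "sgraph G" and "S \<subseteq> neighbours G v"
    and f: "embeds_via f (del_vert F u) (induced G S)"
  shows "embeds_via (f(u := v)) F (induced G (insert v S))"
  unfolding embeds_via_def
proof (intro conjI ballI)
  have f_mem: "f x \<in> S" if "x \<in> verts F" "x \<noteq> u" for x
    using f that by (auto simp: embeds_via_def del_vert_def)
  have "v \<notin> S" using assms(3) not_mem_neighbours_self[OF G] by blast
  then have "v \<notin> f ` (verts F - {u})" using f_mem by blast
  moreover have "inj_on f (verts F - {u})" using f by (simp add: embeds_via_def del_vert_def)
  ultimately have "inj_on (f(u := v)) (insert u (verts F - {u}))"
    by (auto simp: inj_on_def)
  then show "inj_on (f(u := v)) (verts F)" by (rule inj_on_subset) blast
  show "(f(u := v)) ` verts F \<subseteq> verts (induced G (insert v S))" using f_mem by auto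
  fix e assume e: "e \<in> edges F"
  show "(f(u := v)) ` e \<in> edges (induced G (insert v S))"
  proof (cases "u \<in> e")
    case False
    then have "f ` e \<in> edges (induced G S)" using f e by (auto simp: embeds_via_def del_vert_def)
    moreover have "(f(u := v)) ` e = f ` e" using False by auto
    ultimately show ?thesis by auto
  next
    case True
    then obtain z where z: "e = {u, z}" "z \<noteq> u" "z \<in> verts F" by (rule edge_at_vertexE[OF F e])
    then show ?thesis using f_mem[OF z(3,2)] assms(3) by (auto simp: neighbours_def insert_commute)
  qed
qed

lemma not_free_of_insert:
  assumes F: "sgraph F" and G: "sgraph G" and S: "S \<subseteq> neighbours G v"
    and blowup: "has_blowup (induced G S) (chromatic_number (del_vert F u)) (card (verts F))"
  shows "\<not> free_of F (induced G (insert v S))"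
proof -
  have "card (verts (del_vert F u)) \<le> card (verts F)"
    using F by (auto simp: del_vert_def intro: card_mono)
  then have "has_blowup (induced G S) (chromatic_number (del_vert F u)) (card (verts (del_vert F u)))"
    using blowup by (rule has_blowup_antimono)
  moreover have "sgraph (induced G S)"
    using S neighbours_subset_verts[OF G] by (intro sgraph_induced[OF G]) blast
  ultimately obtain f where "embeds_via f (del_vert F u) (induced G S)"
    using not_free_of_if_has_blowup not_free_ofE sgraph_del_vert[OF F] by metis
  then show ?thesis using embeds_via_insert[OF F G S] not_free_ofI[OF F] by blast
qed

definition robust_at :: "'a graph \<Rightarrow> 'b graph \<Rightarrow> nat \<Rightarrow> 'b \<Rightarrow> bool" where
  "robust_at F G z v \<longleftrightarrow>
     (\<forall>Z. finite Z \<longrightarrow> card Z \<le> z \<longrightarrow> v \<notin> Z \<longrightarrow> \<not> free_of F (del_verts G Z))"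

lemma robust_at_high_degree_verts:
  fixes \<delta> :: real
  assumes F: "sgraph F" and r: "chromatic_number (del_vert F u) = r" "0 < r"
    and "0 < \<delta>"
  shows "\<forall>\<^sub>F G in near_extremal r t.
    \<forall>v\<in>high_degree_verts G ((turan_density r + \<delta>) * card (verts G)). robust_at F G z v"
proof -
  have "0 < \<delta> / 2" using \<open>0 < \<delta>\<close> by simp
  then have "\<forall>\<^sub>F G in large_graphs. z \<le> \<delta> / 2 * card (verts G)" by (rule eventually_le_card_verts)
  from has_blowup_in_large_set[OF r(2) \<open>0 < \<delta> / 2\<close>, of "card (verts F)" t]
    eventually_near_extremal_if_large[OF this] eventually_near_extremal_if_large[OF eventually_sgraph]
  show ?thesis
  proof eventually_elim
    case (elim G)
    note G = elim(3)
    show ?case unfolding robust_at_def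
    proof (intro ballI allI impI)
      fix v Z assume v: "v \<in> high_degree_verts G ((turan_density r + \<delta>) * card (verts G))" "v \<notin> Z"
        and Z: "finite Z" "card Z \<le> z"
      define S where "S = neighbours G v - Z"
      have S: "S \<subseteq> neighbours G v" "insert v S \<subseteq> verts G - Z" "S \<subseteq> verts G"
        using neighbours_subset_verts[OF G, of v] v by (auto simp: S_def high_degree_verts_def)
      have "(turan_density r + \<delta> / 2) * card (verts G) \<le> degree G v - real z"
        using v(1) elim(2) by (simp add: high_degree_verts_def algebra_simps)
      also have "\<dots> \<le> card S"
        using diff_card_le_card_Diff[OF Z(1), of "neighbours G v"] Z(2)
        by (simp add: degree_def S_def)
      finally have "has_blowup (induced G S) r (card (verts F))" using elim(1) S(3) by blast
      then have "\<not> free_of F (induced G (insert v S))"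
        using not_free_of_insert[OF F G S(1), of u] r(1) by simp
      then show "\<not> free_of F (del_verts G Z)"
        using free_of_subgraph[OF _ subgraph_induced_mono[OF G S(2)]] by blast
    qed
  qed
qed

subsection \<open>Packings of disjoint copies\<close>

lemma verts_copies: "verts (copies m F) = {..<m} \<times> verts F"
  by (simp add: copies_def)

lemma edges_copies: "edges (copies m F) = {Pair i ` e | i e. i < m \<and> e \<in> edges F}"
  by (simp add: copies_def)

lemma card_verts_copies: "card (verts (copies m F)) = m * card (verts F)"
  by (simp add: verts_copies card_cartesian_product)

lemma sgraph_copies:
  assumes "sgraph F"
  shows "sgraph (copies m F)"
proof -
  have "Pair i ` e \<subseteq> verts (copies m F) \<and> card (Pair i ` e) = 2" if "i < m" "e \<in> edges F" for i e
    using assms that by (auto simp: sgraph_def verts_copies card_image inj_on_def)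
  then show ?thesis using assms by (auto simp: sgraph_def verts_copies edges_copies)
qed

lemma embeds_via_copies_component:
  assumes "embeds_via f (copies m F) G" "i < m"
  shows "embeds_via (\<lambda>x. f (i, x)) F G"
  unfolding embeds_via_def
proof (intro conjI ballI)
  show "inj_on (\<lambda>x. f (i, x)) (verts F)"
    using assms by (auto simp: embeds_via_def verts_copies inj_on_def)
  show "(\<lambda>x. f (i, x)) ` verts F \<subseteq> verts G"
    using assms by (auto simp: embeds_via_def verts_copies)
  fix e assume "e \<in> edges F"
  then have "f ` Pair i ` e \<in> edges G" using assms unfolding embeds_via_def edges_copies by blast
  then show "(\<lambda>x. f (i, x)) ` e \<in> edges G" by (simp add: image_image)
qed

lemma chromatic_number_copies:
  assumes "sgraph F" "0 < h"
  shows "chromatic_number (copies h F) = chromatic_number F"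
proof (rule antisym)
  obtain c where "proper_coloring F (chromatic_number F) c"
    by (rule chromatic_number_coloring[OF assms(1)])
  then have "proper_coloring (copies h F) (chromatic_number F) (c \<circ> snd)"
    by (rule proper_coloring_comp[rotated 2]) (auto simp: verts_copies edges_copies image_image)
  then show "chromatic_number (copies h F) \<le> chromatic_number F" by (rule chromatic_number_le)
next
  obtain c where "proper_coloring (copies h F) (chromatic_number (copies h F)) c"
    by (rule chromatic_number_coloring[OF sgraph_copies[OF assms(1)]])
  then have "proper_coloring F (chromatic_number (copies h F)) (c \<circ> Pair 0)"
    by (rule proper_coloring_comp[rotated 2]) (use assms(2) in \<open>auto simp: verts_copies edges_copies\<close>)
  then show "chromatic_number F \<le> chromatic_number (copies h F)" by (rule chromatic_number_le)
qed

lemma not_free_of_copies_zero: "\<not> free_of (copies 0 F) G"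
  by (rule not_free_ofI[of _ undefined]) (simp_all add: sgraph_def embeds_via_def verts_copies edges_copies)

lemma not_free_of_copies_Suc:
  assumes F: "sgraph F" and XY: "X \<inter> Y = {}"
    and X: "\<not> free_of (copies m F) (induced G X)" and Y: "\<not> free_of F (induced G Y)"
  shows "\<not> free_of (copies (Suc m) F) (induced G (X \<union> Y))"
proof -
  obtain f where f: "embeds_via f (copies m F) (induced G X)"
    by (rule not_free_ofE[OF sgraph_copies[OF F] X])
  obtain g where g: "embeds_via g F (induced G Y)" by (rule not_free_ofE[OF F Y])
  define h where "h = (\<lambda>p. if p \<in> verts (copies m F) then f p else (g \<circ> snd) p)"
  have V: "verts (copies (Suc m) F) = verts (copies m F) \<union> Pair m ` verts F"
    by (auto simp: verts_copies less_Suc_eq)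
  have h_new: "h (m, x) = g x" for x by (simp add: h_def verts_copies)
  have "embeds_via h (copies (Suc m) F) (induced G (X \<union> Y))"
    unfolding embeds_via_def
  proof (intro conjI ballI)
    show "inj_on h (verts (copies (Suc m) F))"
      unfolding V h_def
    proof (rule inj_on_disjoint_Un)
      show "inj_on f (verts (copies m F))" using f by (simp add: embeds_via_def)
      show "inj_on (g \<circ> snd) (Pair m ` verts F)" using g by (auto simp: embeds_via_def inj_on_def)
      show "f ` verts (copies m F) \<inter> (g \<circ> snd) ` Pair m ` verts F = {}"
        using f g XY by (fastforce simp: embeds_via_def)
    qed
    show "h ` verts (copies (Suc m) F) \<subseteq> verts (induced G (X \<union> Y))"
      using f g unfolding V embeds_via_def image_Un by (auto simp: h_new) (auto simp: h_def)
    fix e assume "e \<in> edges (copies (Suc m) F)"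
    then consider (old) "e \<in> edges (copies m F)" | (new) d where "e = Pair m ` d" "d \<in> edges F"
      by (auto simp: edges_copies less_Suc_eq)
    then show "h ` e \<in> edges (induced G (X \<union> Y))"
    proof cases
      case old
      have "h ` e = f ` e"
        using edge_subset_verts[OF sgraph_copies[OF F] old] by (intro image_cong) (auto simp: h_def)
      moreover have "f ` e \<in> edges (induced G X)" using f old unfolding embeds_via_def by blast
      ultimately show ?thesis by auto
    next
      case new
      have "h ` e = g ` d" by (simp add: new image_image h_new)
      moreover have "g ` d \<in> edges (induced G Y)" using g new unfolding embeds_via_def by blast
      ultimately show ?thesis by auto
    qed
  qed
  then show ?thesis by (rule not_free_ofI[OF sgraph_copies[OF F]])
qed

lemma not_free_of_copies_extend:
  assumes F: "sgraph F" and G: "sgraph G" and "finite B" "B \<subseteq> verts G"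
    and "\<forall>v\<in>B. robust_at F G z v"
    and "(j + card B) * (card (verts F) + 1) \<le> z" and "\<not> free_of (copies j F) (del_verts G B)"
  shows "\<not> free_of (copies (j + card B) F) G"
  using assms(3-)
proof (induction B arbitrary: j rule: finite_induct)
  case empty
  then show ?case
    using free_of_subgraph[OF _ subgraph_induced[OF G subset_refl], of "copies j F"] by auto
next
  case (insert b B)
  obtain X where X: "X \<subseteq> verts G - insert b B" "finite X" "card X = j * card (verts F)"
    "\<not> free_of (copies j F) (induced G X)"
    using not_free_of_obtain_support[OF sgraph_copies[OF F] insert.prems(4)]
    by (auto simp: card_verts_copies induced_induced)
  have "card (X \<union> B) \<le> (j + card (insert b B)) * (card (verts F) + 1)"
    using card_Un_le[of X B] X(3) insert.hyps by (simp add: algebra_simps)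
  then have "card (X \<union> B) \<le> z" using insert.prems(3) by (rule order_trans)
  moreover have "finite (X \<union> B)" "b \<notin> X \<union> B" using insert.hyps X(1,2) by auto
  ultimately have "\<not> free_of F (del_verts G (X \<union> B))"
    using insert.prems(2) unfolding robust_at_def by blast
  then have "\<not> free_of (copies (Suc j) F) (induced G (X \<union> (verts G - (X \<union> B))))"
    using X(4) by (intro not_free_of_copies_Suc[OF F]) auto
  moreover have "X \<union> (verts G - (X \<union> B)) = verts G - B" using X(1) by blast
  ultimately have "\<not> free_of (copies (Suc j) F) (del_verts G B)" by simp
  then have "\<not> free_of (copies (Suc j + card B) F) G"
    using insert.prems(1-3) insert.hyps by (intro insert.IH) auto
  then show ?case using insert.hyps by simp
qed

lemma card_less_if_free_of_copies:
  assumes F: "sgraph F" and G: "sgraph G" and A: "A \<subseteq> verts G" and free: "free_of (copies h F) G"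
    and robust: "\<forall>v\<in>A. robust_at F G (h * (card (verts F) + 1)) v"
  shows "card A < h" "free_of (copies (h - card A) F) (del_verts G A)"
proof -
  have extend: "free_of (copies j F) (del_verts G B)" if "B \<subseteq> A" "j + card B = h" for j B
  proof (rule ccontr)
    assume B: "\<not> ?thesis"
    have "B \<subseteq> verts G" using that(1) A by blast
    moreover from this have "finite B" using finite_verts[OF G] by (rule finite_subset)
    ultimately have "\<not> free_of (copies (j + card B) F) G"
      using that B robust by (intro not_free_of_copies_extend[OF F G, where z = "h * (card (verts F) + 1)"]) auto
    then show False using free that(2) by simp
  qed
  show "card A < h"
  proof (rule ccontr)
    assume "\<not> card A < h"
    then obtain B where "B \<subseteq> A" "card B = h" by (meson not_less obtain_subset_with_card_n)
    then show False using extend[of B 0] by (simp add: not_free_of_copies_zero)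
  qed
  then show "free_of (copies (h - card A) F) (del_verts G A)" by (intro extend) auto
qed

lemma ex_hitting_set:
  assumes F: "sgraph F" and G: "sgraph G" and "free_of (copies q F) G"
  shows "\<exists>C\<subseteq>verts G. card C \<le> (q - 1) * card (verts F) \<and> free_of F (del_verts G C)"
  using assms(3)
proof (induction q)
  case 0
  then show ?case using not_free_of_copies_zero by blast
next
  case (Suc q)
  show ?case
  proof (cases "free_of (copies q F) G")
    case True
    then obtain C where C: "C \<subseteq> verts G" "card C \<le> (q - 1) * card (verts F)" "free_of F (del_verts G C)"
      using Suc.IH by blast
    have "(q - 1) * card (verts F) \<le> q * card (verts F)" by (intro mult_right_mono) auto
    then show ?thesis using C by (metis diff_Suc_1 order_trans)
  next
    case False
    then obtain X where X: "X \<subseteq> verts G" "card X = q * card (verts F)" "\<not> free_of (copies q F) (induced G X)"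
      using not_free_of_obtain_support[OF sgraph_copies[OF F]] by (metis card_verts_copies)
    have "X \<union> (verts G - X) = verts G" using X(1) by blast
    then have "free_of (copies (Suc q) F) (induced G (X \<union> (verts G - X)))"
      using free_of_subgraph[OF Suc.prems subgraph_induced[OF G subset_refl]] by simp
    then have "free_of F (del_verts G X)" using not_free_of_copies_Suc[OF F _ X(3), of "verts G - X"] by auto
    then show ?thesis using X(1,2) by auto
  qed
qed

lemma free_of_copies_if_free_of_del_verts:
  assumes F: "sgraph F" and "finite A" "card A < h" and free: "free_of F (del_verts G A)"
  shows "free_of (copies h F) G"
proof (rule ccontr)
  assume "\<not> free_of (copies h F) G"
  then obtain f where f: "embeds_via f (copies h F) G"
    by (rule not_free_ofE[OF sgraph_copies[OF F]])
  have "\<exists>x\<in>verts F. f (i, x) \<in> A" if "i < h" for i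
  proof (rule ccontr)
    assume "\<not> ?thesis"
    then have "embeds_via (\<lambda>x. f (i, x)) F (del_verts G A)"
      using embeds_via_copies_component[OF f that] edge_subset_verts[OF F]
      by (fastforce simp: embeds_via_def)
    then show False using free not_free_ofI[OF F] by blast
  qed
  then obtain x where x: "\<And>i. i < h \<Longrightarrow> x i \<in> verts F \<and> f (i, x i) \<in> A" by metis
  have "inj_on (\<lambda>i. f (i, x i)) {..<h}"
  proof (rule inj_onI)
    fix i j assume ij: "i \<in> {..<h}" "j \<in> {..<h}" "f (i, x i) = f (j, x j)"
    have "inj_on f ({..<h} \<times> verts F)" using f by (simp add: embeds_via_def verts_copies)
    from inj_onD[OF this ij(3)] show "i = j" using ij x by auto
  qed
  moreover have "(\<lambda>i. f (i, x i)) ` {..<h} \<subseteq> A" using x by auto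
  ultimately have "card {..<h} \<le> card A" using \<open>finite A\<close> by (rule card_inj_on_le)
  then show False using \<open>card A < h\<close> by simp
qed

subsection \<open>Extremal graphs are nearly extremal\<close>

lemma card_edges_le_ex_num:
  assumes "sgraph F" "sgraph G" "free_of F G"
  shows "card (edges G) \<le> ex_num (card (verts G)) F"
proof -
  obtain f :: "_ \<Rightarrow> nat" where f: "inj_on f (verts G)"
    using finite_imp_inj_to_nat_seg[OF finite_verts[OF assms(2)]] by blast
  define H where "H = map_graph f G"
  have H: "sgraph H" "card (verts H) = card (verts G)" "free_of F H"
    using assms f by (simp_all add: H_def sgraph_map_graph card_image free_of_map_graph)
  then obtain M where M: "M \<in> EX_set (card (verts G)) F" using EX_set_nonempty by blast
  then have "card (edges H) \<le> card (edges M)" using H unfolding EX_set_def by blast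
  then show ?thesis
    using card_edges_EX_set[OF M] card_edges_map_graph[OF assms(2) f] by (simp add: H_def)
qed

lemma mem_EX_set_iff:
  assumes "sgraph F"
  shows "G \<in> EX_set n F \<longleftrightarrow>
    sgraph G \<and> card (verts G) = n \<and> free_of F G \<and> card (edges G) = ex_num n F"
proof
  assume "G \<in> EX_set n F"
  then show "sgraph G \<and> card (verts G) = n \<and> free_of F G \<and> card (edges G) = ex_num n F"
    using card_edges_EX_set[OF \<open>G \<in> EX_set n F\<close>] by (simp add: EX_set_def)
next
  assume G: "sgraph G \<and> card (verts G) = n \<and> free_of F G \<and> card (edges G) = ex_num n F"
  have "card (edges G') \<le> ex_num n F"
    if "sgraph G'" "card (verts G') = n" "free_of F G'" for G' :: "nat graph"
    using card_edges_le_ex_num[OF assms that(1,3)] that(2) by simp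
  then show "G \<in> EX_set n F" using G by (simp add: EX_set_def del: split_paired_All)
qed

definition turan_graph :: "nat \<Rightarrow> nat \<Rightarrow> nat graph" where
  "turan_graph r n = ({..<n}, {{x, y} | x y. x < n \<and> y < n \<and> x mod r \<noteq> y mod r})"

lemma verts_turan_graph [simp]: "verts (turan_graph r n) = {..<n}"
  by (simp add: turan_graph_def)

lemma sgraph_turan_graph: "sgraph (turan_graph r n)"
  by (auto simp: sgraph_def turan_graph_def card_2_iff)

lemma edge_turan_graph_iff:
  "{x, y} \<in> edges (turan_graph r n) \<longleftrightarrow> x < n \<and> y < n \<and> x mod r \<noteq> y mod r"
  by (auto simp: turan_graph_def doubleton_eq_iff)

lemma proper_coloring_turan_graph: "0 < r \<Longrightarrow> proper_coloring (turan_graph r n) r (\<lambda>x. x mod r)"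
  by (auto simp: proper_coloring_def edge_turan_graph_iff)

lemma card_residue_class_le: "card {x. x < n \<and> x mod r = c} \<le> n div r + 1"
proof -
  have "inj_on (\<lambda>x. x div r) {x. x < n \<and> x mod r = c}"
    by (rule inj_onI) (metis (mono_tags, lifting) div_mult_mod_eq mem_Collect_eq)
  then have "card {x. x < n \<and> x mod r = c} = card ((\<lambda>x. x div r) ` {x. x < n \<and> x mod r = c})"
    by (simp add: card_image)
  also have "\<dots> \<le> card {..n div r}" by (intro card_mono) (auto intro: div_le_mono)
  finally show ?thesis by simp
qed

lemma degree_turan_graph_ge:
  assumes "v < n"
  shows "n - (n div r + 1) \<le> degree (turan_graph r n) v"
proof -
  have "neighbours (turan_graph r n) v = {..<n} - {x. x < n \<and> x mod r = v mod r}"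
    using assms by (auto simp: neighbours_def edge_turan_graph_iff)
  moreover have "card ({..<n} - {x. x < n \<and> x mod r = v mod r}) = n - card {x. x < n \<and> x mod r = v mod r}"
    by (subst card_Diff_subset) auto
  ultimately have "degree (turan_graph r n) v = n - card {x. x < n \<and> x mod r = v mod r}"
    by (simp add: degree_def)
  then show ?thesis using card_residue_class_le[of n r "v mod r"] by simp
qed

lemma edge_density_turan_graph_ge:
  assumes "0 < n"
  shows "turan_density r - 1 / n \<le> edge_density (turan_graph r n)"
proof -
  have "n * (n - (n div r + 1)) \<le> 2 * card (edges (turan_graph r n))"
    using sum_bounded_below[of "{..<n}" "n - (n div r + 1)" "degree (turan_graph r n)"]
      degree_turan_graph_ge sum_degree[OF sgraph_turan_graph, of r n] by simp
  then have "real n * real (n - (n div r + 1)) \<le> 2 * card (edges (turan_graph r n))"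
    by (metis of_nat_le_iff of_nat_mult)
  moreover have "n - n / r - 1 \<le> real (n - (n div r + 1))"
    using of_nat_div_le_of_nat[of n r, where 'a = real] by linarith
  ultimately have "n * (n - n / r - 1) \<le> 2 * card (edges (turan_graph r n))"
    by (meson mult_left_mono of_nat_0_le_iff order_trans)
  moreover have "(turan_density r - 1 / n) * real n ^ 2 = n * (n - n / r - 1)"
    using assms by (simp add: turan_density_def power2_eq_square field_simps)
  ultimately have "(turan_density r - 1 / n) * real n ^ 2 \<le> edge_density (turan_graph r n) * real n ^ 2"
    using double_card_edges[OF sgraph_turan_graph, of r n] by simp
  then show ?thesis using assms by simp
qed

lemma EX_set_not_empty:
  assumes "sgraph F" "2 \<le> chromatic_number F"
  shows "EX_set n F \<noteq> {}"
proof -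
  have "free_of F (turan_graph 1 n)"
    using assms proper_coloring_turan_graph[of 1 n]
    by (intro free_of_if_chromatic_number_greater) auto
  then show ?thesis by (intro EX_set_nonempty[OF sgraph_turan_graph]) auto
qed

lemma edge_density_EX_set_ge:
  assumes F: "sgraph F" and r: "0 < r" "r < chromatic_number F" and G: "G \<in> EX_set n F" and "0 < n"
  shows "turan_density r - 1 / n \<le> edge_density G"
proof -
  have "free_of F (turan_graph r n)"
    by (rule free_of_if_chromatic_number_greater[OF F proper_coloring_turan_graph[OF r(1)] r(2)])
  then have "card (edges (turan_graph r n)) \<le> card (edges G)"
    using card_edges_le_ex_num[OF F sgraph_turan_graph] card_edges_EX_set[OF G] by simp
  then have "edge_density (turan_graph r n) \<le> edge_density G"
    using G by (auto simp: edge_density_def mem_EX_set_iff[OF F] intro!: divide_right_mono)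
  then show ?thesis using edge_density_turan_graph_ge[OF \<open>0 < n\<close>, of r] by linarith
qed

lemma eventually_EX_set:
  assumes F: "sgraph F" "chromatic_number F = Suc r" "0 < r"
    and "eventually P (near_extremal r (card (verts F)))"
  shows "\<forall>\<^sub>F n in sequentially. \<forall>G\<in>EX_set n F. P G"
proof -
  obtain \<eta> :: real and N where "0 < \<eta>" and N: "\<And>G. sgraph G \<Longrightarrow> N \<le> card (verts G) \<Longrightarrow>
      turan_density r - \<eta> \<le> edge_density G \<Longrightarrow> \<not> has_blowup G (Suc r) (card (verts F)) \<Longrightarrow> P G"
    using assms(4) unfolding eventually_near_extremal eventually_large_graphs by metis
  obtain n0 :: nat where n0: "1 / \<eta> < n0" using reals_Archimedean2 by blast
  show ?thesis
    using eventually_ge_at_top[of N] eventually_ge_at_top[of n0] eventually_gt_at_top[of 0]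
  proof eventually_elim
    case (elim n)
    have "1 / \<eta> < n" using n0 elim(2) by linarith
    then have "1 / n \<le> \<eta>" using \<open>0 < \<eta>\<close> elim(3) by (simp add: field_simps)
    show ?case
    proof
      fix G assume GX: "G \<in> EX_set n F"
      then have G: "sgraph G" "card (verts G) = n" "free_of F G" by (auto simp: EX_set_def)
      have "turan_density r - \<eta> \<le> edge_density G"
        using edge_density_EX_set_ge[OF F(1,3) _ GX elim(3)] F(2) \<open>1 / n \<le> \<eta>\<close> by simp
      moreover have "\<not> has_blowup G (Suc r) (card (verts F))"
        using not_free_of_if_has_blowup[OF F(1) G(1)] F(2) G(3) by auto
      ultimately show "P G" using N G(1,2) elim(1) by simp
    qed
  qed
qed

subsection \<open>Growth of the extremal number\<close>

definition add_vertex :: "'a graph \<Rightarrow> 'a \<Rightarrow> 'a set \<Rightarrow> 'a graph" where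
  "add_vertex G v W = (insert v (verts G), edges G \<union> (\<lambda>w. {v, w}) ` W)"

lemma sgraph_add_vertex:
  assumes "sgraph G" "v \<notin> verts G" "W \<subseteq> verts G"
  shows "sgraph (add_vertex G v W)"
proof -
  have "card {v, w} = 2" if "w \<in> W" for w using assms that by (intro card_2_iff[THEN iffD2]) blast
  then show ?thesis using assms by (auto simp: sgraph_def add_vertex_def)
qed

lemma card_verts_add_vertex:
  "sgraph G \<Longrightarrow> v \<notin> verts G \<Longrightarrow> card (verts (add_vertex G v W)) = Suc (card (verts G))"
  by (simp add: add_vertex_def)

lemma card_edges_add_vertex:
  assumes "sgraph G" "v \<notin> verts G" "W \<subseteq> verts G"
  shows "card (edges (add_vertex G v W)) = card (edges G) + card W"
proof -
  have "edges G \<inter> (\<lambda>w. {v, w}) ` W = {}" using assms by (auto simp: sgraph_def)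
  moreover have "finite W" using assms by (auto intro: finite_subset)
  moreover have "inj_on (\<lambda>w. {v, w}) W" by (auto simp: inj_on_def doubleton_eq_iff)
  ultimately show ?thesis
    using assms(1) by (simp add: add_vertex_def card_Un_disjoint card_image)
qed

lemma embeds_via_replace_new_vertex:
  assumes F: "sgraph F" and G: "sgraph G" and v: "v \<notin> verts G"
    and f: "embeds_via f F (add_vertex G v W)" and u: "u \<in> verts F" "f u = v"
    and s: "s \<in> verts G" "s \<notin> f ` (verts F - {u})" "W \<subseteq> neighbours G s"
  shows "embeds_via (f(u := s)) F G"
  unfolding embeds_via_def
proof (intro conjI ballI)
  have inj: "inj_on f (verts F)" using f by (simp add: embeds_via_def)
  have f_mem: "f x \<in> verts G" "f x \<noteq> v" if "x \<in> verts F" "x \<noteq> u" for x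
    using f u that inj_onD[OF inj, of x u] by (auto simp: embeds_via_def add_vertex_def)
  have edge: "f ` e \<in> edges G \<union> (\<lambda>w. {v, w}) ` W" if "e \<in> edges F" for e
    using f that by (auto simp: embeds_via_def add_vertex_def)
  show "inj_on (f(u := s)) (verts F)"
    using s(2) inj by (auto simp: inj_on_def)
  show "(f(u := s)) ` verts F \<subseteq> verts G" using f_mem(1) s(1) by auto
  fix e assume e: "e \<in> edges F"
  show "(f(u := s)) ` e \<in> edges G"
  proof (cases "u \<in> e")
    case False
    then have "v \<notin> f ` e" using f_mem(2) edge_subset_verts[OF F e] by blast
    then have "f ` e \<in> edges G" using edge[OF e] by auto
    moreover have "(f(u := s)) ` e = f ` e" using False by auto
    ultimately show ?thesis by simp
  next
    case True
    then obtain z where z: "e = {u, z}" "z \<noteq> u" "z \<in> verts F" by (rule edge_at_vertexE[OF F e])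
    then have "{v, f z} \<in> edges G \<union> (\<lambda>w. {v, w}) ` W" using edge[OF e] u(2) by simp
    then have "f z \<in> W" using edge_subset_verts[OF G] v by (auto simp: doubleton_eq_iff)
    then show ?thesis using s(3) z by (auto simp: neighbours_def insert_commute)
  qed
qed

text \<open>If a copy of \<open>F\<close> uses the new vertex, a vertex of \<open>S\<close> outside the copy can take its place.\<close>

lemma free_of_add_vertex:
  assumes F: "sgraph F" and G: "sgraph G" and free: "free_of F G" and v: "v \<notin> verts G"
    and S: "S \<subseteq> verts G" "card (verts F) \<le> card S"
  shows "free_of F (add_vertex G v (common_neighbours G S))"
proof (rule ccontr)
  assume "\<not> free_of F (add_vertex G v (common_neighbours G S))"
  then obtain f where f: "embeds_via f F (add_vertex G v (common_neighbours G S))"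
    by (rule not_free_ofE[OF F])
  show False
  proof (cases "v \<in> f ` verts F")
    case True
    then obtain u where u: "u \<in> verts F" "f u = v" by blast
    have "card (f ` (verts F - {u})) \<le> card (verts F - {u})" using F by (simp add: card_image_le)
    also have "\<dots> < card S" using u(1) F S(2) card_Diff1_less[of "verts F" u] by simp
    finally have "\<not> S \<subseteq> f ` (verts F - {u})" using F card_mono[of "f ` (verts F - {u})" S] by auto
    then obtain s where s: "s \<in> S" "s \<notin> f ` (verts F - {u})" by blast
    moreover have "common_neighbours G S \<subseteq> neighbours G s"
      using s(1) mem_neighbours_commute[of s G] by (auto simp: common_neighbours_def)
    ultimately have "embeds_via (f(u := s)) F G"
      using embeds_via_replace_new_vertex[OF F G v f u] S(1) by blast
    then show ?thesis using free not_free_ofI[OF F] by blast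
  next
    case False
    have "f ` e \<in> edges G" if "e \<in> edges F" for e
    proof -
      have "v \<notin> f ` e" using False edge_subset_verts[OF F that] by blast
      then show ?thesis using f that by (auto simp: embeds_via_def add_vertex_def)
    qed
    then have "embeds_via f F G" using f False by (auto simp: embeds_via_def add_vertex_def)
    then show ?thesis using free not_free_ofI[OF F] by blast
  qed
qed

lemma ex_num_Suc_ge:
  fixes \<epsilon> :: real
  assumes F: "sgraph F" "chromatic_number F = Suc r" "0 < r" and "0 < \<epsilon>"
  shows "\<forall>\<^sub>F n in sequentially. ex_num n F + (turan_density r - \<epsilon>) * n \<le> ex_num (Suc n) F"
  using eventually_EX_set[OF F large_common_neighbourhood[OF F(3) \<open>0 < \<epsilon>\<close>]]
proof eventually_elim
  case (elim n)
  obtain G where GX: "G \<in> EX_set n F" using EX_set_not_empty[OF F(1), of n] F(2,3) by auto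
  then have G: "sgraph G" "card (verts G) = n" "free_of F G" "card (edges G) = ex_num n F"
    by (auto simp: mem_EX_set_iff[OF F(1)])
  obtain S where S: "S \<subseteq> verts G" "card S = card (verts F)"
    and W: "(turan_density r - \<epsilon>) * n \<le> card (common_neighbours G S)"
    using elim GX G(2) by blast
  obtain v where v: "v \<notin> verts G"
    using ex_new_if_finite[OF infinite_UNIV_nat finite_verts[OF G(1)]] by blast
  have "common_neighbours G S \<subseteq> verts G" by (auto simp: common_neighbours_def)
  note H = sgraph_add_vertex[OF G(1) v this] card_edges_add_vertex[OF G(1) v this]
  have "card (edges G) + card (common_neighbours G S) \<le> ex_num (Suc n) F"
    using card_edges_le_ex_num[OF F(1) H(1) free_of_add_vertex[OF F(1) G(1,3) v S(1)]] S(2) H(2) G(2)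
    by (simp add: card_verts_add_vertex[OF G(1) v])
  then show ?case using W G(4) by linarith
qed

lemma ex_num_add_ge:
  fixes \<epsilon> :: real
  assumes F: "sgraph F" "chromatic_number F = Suc r" "0 < r" and "0 < \<epsilon>" "\<epsilon> \<le> turan_density r"
  shows "\<forall>\<^sub>F n in sequentially. \<forall>s. ex_num n F + s * ((turan_density r - \<epsilon>) * n) \<le> ex_num (n + s) F"
  using eventually_all_ge_at_top[OF ex_num_Suc_ge[OF assms(1-4)]]
proof eventually_elim
  case (elim n)
  show ?case
  proof
    fix s show "ex_num n F + s * ((turan_density r - \<epsilon>) * n) \<le> ex_num (n + s) F"
    proof (induction s)
      case (Suc s)
      have "(turan_density r - \<epsilon>) * n \<le> (turan_density r - \<epsilon>) * (n + s)"
        using assms(5) by (intro mult_left_mono) auto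
      moreover have "ex_num (n + s) F + (turan_density r - \<epsilon>) * (n + s) \<le> ex_num (Suc (n + s)) F"
        using elim[rule_format, of "n + s"] by simp
      ultimately show ?case using Suc.IH by (simp add: algebra_simps)
    qed simp
  qed
qed

subsection \<open>Joins\<close>

lemma verts_join [simp]: "verts (join K H) = verts K <+> verts H"
  by (simp add: join_def)

lemma edges_join: "edges (join K H) = (`) Inl ` edges K \<union> (`) Inr ` edges H \<union>
    (\<lambda>(u, v). {Inl u, Inr v}) ` (verts K \<times> verts H)"
  by (auto simp: join_def)

lemma sgraph_join:
  assumes "sgraph K" "sgraph H"
  shows "sgraph (join K H)"
  unfolding sgraph_def
proof (intro conjI ballI)
  show "finite (verts (join K H))" using assms by simp
  fix e assume "e \<in> edges (join K H)"
  then consider d where "d \<in> edges K" "e = Inl ` d" | d where "d \<in> edges H" "e = Inr ` d"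
    | u v where "u \<in> verts K" "v \<in> verts H" "e = {Inl u, Inr v}"
    by (auto simp: edges_join)
  then have "e \<subseteq> verts (join K H) \<and> card e = 2"
    using assms by cases (auto simp: sgraph_def card_image)
  then show "e \<subseteq> verts (join K H)" "card e = 2" by simp_all
qed

lemma card_edges_join:
  fixes K :: "'a graph" and H :: "'b graph"
  assumes K: "sgraph K" and H: "sgraph H"
  shows "card (edges (join K H)) = card (edges K) + card (edges H) + card (verts K) * card (verts H)"
proof -
  let ?cross = "(\<lambda>(u, v). {Inl u, Inr v}) ` (verts K \<times> verts H)"
  have "Inl ` d \<noteq> Inr ` e" if "d \<in> edges K" for d and e :: "'b set"
    using edge_not_empty[OF K that] by blast
  then have "(`) Inl ` edges K \<inter> (`) Inr ` edges H = {}" by blast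
  moreover have "((`) Inl ` edges K \<union> (`) Inr ` edges H) \<inter> ?cross = {}" by auto
  moreover have "card ?cross = card (verts K) * card (verts H)"
    by (subst card_image) (auto simp: inj_on_def doubleton_eq_iff card_cartesian_product)
  moreover have "card ((`) Inl ` edges K :: ('a + 'b) set set) = card (edges K)"
    "card ((`) Inr ` edges H :: ('a + 'b) set set) = card (edges H)"
    using card_edges_map_graph[OF K, of Inl] card_edges_map_graph[OF H, of Inr] by simp_all
  ultimately show ?thesis using assms by (simp add: edges_join card_Un_disjoint)
qed

lemma card_edges_complete_graph: "card (edges (complete_graph m)) = m choose 2"
  using n_subsets[of "{..<m}" 2] by (simp add: complete_graph_def)

lemma verts_complete_graph [simp]: "verts (complete_graph m) = {..<m}"
  by (simp add: complete_graph_def)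

lemma sgraph_complete_graph: "sgraph (complete_graph m)"
  by (simp add: sgraph_def complete_graph_def)

lemma free_of_copies_join:
  assumes F: "sgraph F" and K: "sgraph K" "card (verts K) < h" and H: "sgraph H" "free_of F H"
  shows "free_of (copies h F) (join K H)"
proof (rule free_of_copies_if_free_of_del_verts[OF F])
  have V: "verts (join K H) - Inl ` verts K = Inr ` verts H" by auto
  have "\<not> Inl ` d \<subseteq> Inr ` verts H" if "d \<in> edges K" for d
    using edge_not_empty[OF K(1) that] by blast
  moreover have "Inr ` d \<subseteq> Inr ` verts H" if "d \<in> edges H" for d
    using edge_subset_verts[OF H(1) that] by blast
  ultimately have "edges (del_verts (join K H) (Inl ` verts K)) = (`) Inr ` edges H"
    unfolding edges_induced V edges_join by blast
  then have "del_verts (join K H) (Inl ` verts K) = map_graph Inr H"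
    using V by (simp add: prod_eq_iff)
  then show "free_of F (del_verts (join K H) (Inl ` verts K))"
    using free_of_map_graph[OF F H, of Inr] by simp
qed (use K in \<open>simp_all add: card_image\<close>)

lemma card_edges_le_if_embeds_via:
  assumes G: "sgraph G" and H: "sgraph H" and f: "embeds_via f G H"
  shows "card (edges G) \<le> card (edges H)"
proof (rule card_inj_on_le)
  show "inj_on ((`) f) (edges G)"
    using f by (intro inj_on_image_edges[OF G]) (simp add: embeds_via_def)
qed (use f H in \<open>auto simp: embeds_via_def\<close>)

lemma isomorphic_if_embeds_via:
  assumes G: "sgraph G" and H: "sgraph H" and f: "embeds_via f G H"
    and "card (verts H) \<le> card (verts G)" "card (edges H) \<le> card (edges G)"
  shows "isomorphic G H"
proof -
  have inj: "inj_on f (verts G)" using f by (simp add: embeds_via_def)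
  have "f ` verts G = verts H"
    using f H assms(4) card_image[OF inj] by (intro card_seteq) (auto simp: embeds_via_def)
  moreover have "(`) f ` edges G = edges H"
    using f H assms(5) card_image[OF inj_on_image_edges[OF G inj]]
    by (intro card_seteq) (auto simp: embeds_via_def)
  ultimately show ?thesis using inj unfolding isomorphic_def bij_betw_def by blast
qed

lemma embeds_via_join_del_verts:
  assumes G: "sgraph G" and "finite A"
  obtains f where "embeds_via f G (join (complete_graph (card A)) (del_verts G A))"
proof -
  let ?J = "join (complete_graph (card A)) (del_verts G A)"
  obtain b where b: "inj_on b A" "b ` A = {..<card A}"
    using ex_bij_betw_finite_nat[OF \<open>finite A\<close>] by (auto simp: bij_betw_def atLeast0LessThan)
  define f where "f x = (if x \<in> A then Inl (b x) else Inr x)" for x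
  have b_less: "b z < card A" if "z \<in> A" for z using b(2) that by blast
  have "embeds_via f G ?J" unfolding embeds_via_def
  proof (intro conjI ballI)
    show "inj_on f (verts G)" using b(1) by (auto simp: f_def inj_on_def)
    show "f ` verts G \<subseteq> verts ?J" using b_less by (auto simp: f_def)
    fix e assume "e \<in> edges G"
    then obtain x y where e: "e = {x, y}" "x \<noteq> y" "x \<in> verts G" "y \<in> verts G" by (rule edgeE[OF G])
    have "{Inl u, Inl v} \<in> edges ?J" if "u < card A" "v < card A" "u \<noteq> v" for u v
      using that by (auto simp: edges_join complete_graph_def intro!: image_eqI[of _ _ "{u, v}"])
    moreover have "{Inr u, Inr v} \<in> edges ?J" if "{u, v} \<in> edges G" "{u, v} \<subseteq> verts G - A" for u v
      using that by (auto simp: edges_join intro!: image_eqI[of _ _ "{u, v}"])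
    moreover have "{Inl u, Inr v} \<in> edges ?J" "{Inr v, Inl u} \<in> edges ?J"
      if "u < card A" "v \<in> verts G - A" for u v
      using that by (auto simp: edges_join insert_commute)
    moreover have "f ` e = {f x, f y}" using e(1) by simp
    moreover have "x \<in> A \<Longrightarrow> y \<in> A \<Longrightarrow> b x \<noteq> b y" using b(1) e(2) by (auto dest: inj_onD)
    ultimately show "f ` e \<in> edges ?J"
      using e \<open>e \<in> edges G\<close> b_less by (cases "x \<in> A"; cases "y \<in> A") (simp_all add: f_def)
  qed
  then show thesis by (rule that)
qed

lemma ex_num_copies_ge:
  assumes F: "sgraph F" "2 \<le> chromatic_number F" and l: "1 \<le> l" "l \<le> h" "l \<le> n"
  shows "((l - 1) choose 2) + (l - 1) * (n - l + 1) + ex_num (n - l + 1) F \<le> ex_num n (copies h F)"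
proof -
  obtain H where "H \<in> EX_set (n - l + 1) F" using EX_set_not_empty[OF F] by blast
  then have H: "sgraph H" "card (verts H) = n - l + 1" "free_of F H" "card (edges H) = ex_num (n - l + 1) F"
    by (auto simp: mem_EX_set_iff[OF F(1)])
  define J where "J = join (complete_graph (l - 1)) H"
  have "free_of (copies h F) J"
    unfolding J_def using F(1) H(1,3) l by (intro free_of_copies_join) (auto simp: sgraph_complete_graph)
  moreover have "sgraph J"
    unfolding J_def using H(1) by (simp add: sgraph_join sgraph_complete_graph)
  ultimately have "card (edges J) \<le> ex_num (card (verts J)) (copies h F)"
    using F(1) by (intro card_edges_le_ex_num) (simp_all add: sgraph_copies)
  moreover have "card (verts J) = n" using H(1,2) l by (simp add: J_def card_Plus)
  moreover have "card (edges J) = ((l - 1) choose 2) + (l - 1) * (n - l + 1) + card (edges H)"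
    using H(1,2)
    by (simp add: J_def card_edges_join sgraph_complete_graph card_edges_complete_graph)
  ultimately show ?thesis using H(4) by simp
qed

lemma EX_set_copies_join:
  assumes F: "sgraph F" "2 \<le> chromatic_number F" and h: "1 \<le> h" "h \<le> n"
    and GX: "G \<in> EX_set n (copies h F)"
    and A: "A \<subseteq> verts G" "card A = h - 1" "free_of F (del_verts G A)"
  shows "ex_num n (copies h F) = ((h - 1) choose 2) + (h - 1) * (n - h + 1) + ex_num (n - h + 1) F"
    and "\<exists>H\<in>EX_set (n - h + 1) F. isomorphic G (join (complete_graph (h - 1)) H)"
proof -
  define H where "H = del_verts G A"
  define J where "J = join (complete_graph (h - 1)) H"
  have G: "sgraph G" "card (verts G) = n" "card (edges G) = ex_num n (copies h F)"
    using GX by (auto simp: mem_EX_set_iff[OF sgraph_copies[OF F(1)]])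
  have "finite A" using A(1) finite_verts[OF G(1)] by (rule finite_subset)
  then have cH: "card (verts H) = n - h + 1"
    using A(1,2) G(2) h by (simp add: H_def card_Diff_subset)
  have H: "sgraph H" "free_of F H" using A(3) G(1) by (simp_all add: H_def sgraph_induced)
  have J: "sgraph J" using H(1) by (simp add: J_def sgraph_join sgraph_complete_graph)
  have eJ: "card (edges J) = ((h - 1) choose 2) + (h - 1) * (n - h + 1) + card (edges H)"
    using H(1) cH
    by (simp add: J_def card_edges_join sgraph_complete_graph card_edges_complete_graph)
  obtain f where f: "embeds_via f G J"
    using embeds_via_join_del_verts[OF G(1) \<open>finite A\<close>] unfolding J_def H_def A(2) .
  then have "ex_num n (copies h F) \<le> card (edges J)"
    using card_edges_le_if_embeds_via[OF G(1) J] G(3) by simp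
  moreover have "card (edges H) \<le> ex_num (n - h + 1) F"
    using card_edges_le_ex_num[OF F(1) H] cH by simp
  moreover have "((h - 1) choose 2) + (h - 1) * (n - h + 1) + ex_num (n - h + 1) F \<le> ex_num n (copies h F)"
    by (rule ex_num_copies_ge[OF F h(1) order_refl h(2)])
  ultimately have eq: "card (edges J) = ex_num n (copies h F)" "card (edges H) = ex_num (n - h + 1) F"
    using eJ by linarith+
  show "ex_num n (copies h F) = ((h - 1) choose 2) + (h - 1) * (n - h + 1) + ex_num (n - h + 1) F"
    using eJ eq by simp
  have "card (verts J) = card (verts G)"
    using cH G(2) H(1) h by (simp add: J_def card_Plus)
  then have "isomorphic G J"
    using eq(1) G(3) by (intro isomorphic_if_embeds_via[OF G(1) J f]) simp_all
  moreover have "H \<in> EX_set (n - h + 1) F" using H cH eq(2) by (simp add: mem_EX_set_iff[OF F(1)])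
  ultimately show "\<exists>H\<in>EX_set (n - h + 1) F. isomorphic G (join (complete_graph (h - 1)) H)"
    by (auto simp: J_def)
qed

subsection \<open>Extremal graphs for disjoint copies\<close>

lemma card_edges_le_if_free_of_del_verts:
  fixes D :: real
  assumes F: "sgraph F" and G: "sgraph G" and A: "A \<subseteq> verts G" and C: "C \<subseteq> verts G - A"
    and free: "free_of F (del_verts G (A \<union> C))"
    and low: "\<And>v. v \<in> verts G - A \<Longrightarrow> degree G v \<le> D"
    and M: "card C \<le> M" "M + card A \<le> card (verts G)"
  shows "card (edges G) \<le>
    ex_num (card (verts G) - card A - M) F + card A * real (card (verts G)) + M * D"
proof -
  have finite: "finite A" "finite (verts G - A)" using A G by (auto intro: finite_subset)
  have "card (verts G - A) = card (verts G) - card A"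
    using A finite(1) by (simp add: card_Diff_subset)
  then obtain B where B: "C \<subseteq> B" "B \<subseteq> verts G - A" "card B = M"
    using exists_subset_between[OF M(1) _ C finite(2)] M(2) by (metis add_le_imp_le_diff)
  have "finite B" using B(2) finite(2) by (rule finite_subset)
  have "card (verts G - (A \<union> B)) = card (verts G) - card A - M"
  proof -
    have "card (A \<union> B) = card A + M"
      using B(2,3) finite(1) \<open>finite B\<close> by (subst card_Un_disjoint) auto
    moreover have "A \<union> B \<subseteq> verts G" using A B(2) by blast
    ultimately show ?thesis using finite(1) \<open>finite B\<close> by (simp add: card_Diff_subset)
  qed
  moreover have "free_of F (del_verts G (A \<union> B))"
    using subgraph_induced_mono[OF G, of "verts G - (A \<union> B)" "verts G - (A \<union> C)"] B(1)
    by (intro free_of_subgraph[OF free]) auto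
  ultimately have "card (edges (del_verts G (A \<union> B))) \<le> ex_num (card (verts G) - card A - M) F"
    using card_edges_le_ex_num[OF F sgraph_induced[OF G Diff_subset, of "A \<union> B"]] by simp
  moreover have "card (edges G) \<le> card (edges (del_verts G (A \<union> B))) + (\<Sum>v\<in>A \<union> B. degree G v)"
    using card_edges_le_del_verts[OF G, of "A \<union> B"] finite(1) \<open>finite B\<close> by simp
  moreover have "(\<Sum>v\<in>A \<union> B. degree G v) = (\<Sum>v\<in>A. degree G v) + (\<Sum>v\<in>B. degree G v)"
    using B(2) finite(1) \<open>finite B\<close> by (intro sum.union_disjoint) auto
  moreover have "(\<Sum>v\<in>A. degree G v) \<le> card A * card (verts G)"
    using sum_bounded_above[of A "degree G"] degree_le_card_verts[OF G] by simp
  moreover have "(\<Sum>v\<in>B. real (degree G v)) \<le> M * D"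
    using sum_bounded_above[of B "\<lambda>v. real (degree G v)" D] low B(2,3) by auto
  ultimately show ?thesis by (simp flip: of_nat_mult of_nat_sum)
qed

lemma EX_set_copies_edge_count:
  fixes D :: real
  assumes F: "sgraph F" "2 \<le> chromatic_number F" and GX: "G \<in> EX_set n (copies (Suc q) F)"
    and "A \<subseteq> verts G" "C \<subseteq> verts G - A" "free_of F (del_verts G (A \<union> C))"
    and "\<And>v. v \<in> verts G - A \<Longrightarrow> degree G v \<le> D" "card C \<le> M" "M + card A \<le> n" "q < n"
  shows "q * (real n - q) + ex_num (n - q) F \<le> ex_num (n - card A - M) F + card A * real n + M * D"
proof -
  have G: "sgraph G" "card (verts G) = n" "card (edges G) = ex_num n (copies (Suc q) F)"
    using GX by (auto simp: mem_EX_set_iff[OF sgraph_copies[OF F(1)]])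
  have "q * (n - q) + ex_num (n - q) F \<le> card (edges G)"
    using ex_num_copies_ge[OF F, of "Suc q" "Suc q" n] \<open>q < n\<close> G(3) by (simp add: Suc_diff_Suc)
  then have "real (q * (n - q) + ex_num (n - q) F) \<le> card (edges G)" by (rule of_nat_mono)
  then have "q * (real n - q) + ex_num (n - q) F \<le> card (edges G)"
    using \<open>q < n\<close> by (simp add: of_nat_diff)
  also have "\<dots> \<le> ex_num (n - card A - M) F + card A * real n + M * D"
    using card_edges_le_if_free_of_del_verts[OF F(1) G(1) assms(4-8)] assms(9) G(2) by simp
  finally show ?thesis .
qed

text \<open>With \<open>a < H\<close> high-degree vertices the coefficient of \<open>n\<close> on the right exceeds the one on the
  left by at least \<open>(H - a) (1 - p) - 2 M \<epsilon>\<close>.\<close>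

lemma eventually_linear_gap:
  fixes a H M p \<epsilon> :: real
  assumes "a + 1 \<le> H" "p \<le> 1" "0 \<le> \<epsilon>" "2 * M * \<epsilon> < 1 - p"
  shows "\<forall>\<^sub>F n in sequentially.
    a * n + M * ((p + \<epsilon>) * n) < H * (n - H) + (M + a - H) * ((p - \<epsilon>) * (n - (a + M)))"
proof -
  define \<kappa> where "\<kappa> = (H - a) * (1 - p) - (2 * M + a - H) * \<epsilon>"
  define K where "K = H * H + (M + a - H) * ((p - \<epsilon>) * (a + M))"
  have "1 * (1 - p) \<le> (H - a) * (1 - p)" using assms(1,2) by (intro mult_right_mono) auto
  moreover have "(2 * M + a - H) * \<epsilon> \<le> 2 * M * \<epsilon>" using assms(1,3) by (intro mult_right_mono) auto
  ultimately have "0 < \<kappa>" using assms(4) by (simp add: \<kappa>_def)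
  obtain N :: nat where "K / \<kappa> < N" using reals_Archimedean2 by blast
  show ?thesis using eventually_ge_at_top[of N]
  proof eventually_elim
    case (elim n)
    then have "K / \<kappa> < n" using \<open>K / \<kappa> < N\<close> by linarith
    then have "K < \<kappa> * n" using \<open>0 < \<kappa>\<close> by (simp add: field_simps)
    then show ?case by (simp add: K_def \<kappa>_def algebra_simps)
  qed
qed

lemma eventually_ex_num_gap:
  fixes \<epsilon> :: real
  assumes F: "sgraph F" "chromatic_number F = Suc r" "0 < r"
    and \<epsilon>: "0 < \<epsilon>" "\<epsilon> \<le> turan_density r" "2 * M * \<epsilon> < 1 / r" and "q < M"
  shows "\<forall>\<^sub>F n in sequentially. \<forall>a<q.
    ex_num (n - a - M) F + a * real n + M * ((turan_density r + \<epsilon>) * n) < q * (real n - q) + ex_num (n - q) F"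
proof -
  define p where "p = turan_density r"
  have "\<forall>\<^sub>F n in sequentially. \<forall>m\<ge>n - (q + M). \<forall>s. ex_num m F + s * ((p - \<epsilon>) * m) \<le> ex_num (m + s) F"
    using eventually_all_ge_at_top[OF ex_num_add_ge[OF F \<epsilon>(1,2)]] filterlim_minus_const_nat_at_top
    unfolding p_def filterlim_iff by blast
  moreover have "\<forall>\<^sub>F n in sequentially. \<forall>a\<in>{..<q}. real a * n + M * ((p + \<epsilon>) * n) <
      q * (real n - q) + (M + real a - q) * ((p - \<epsilon>) * (real n - (real a + M)))"
    using \<epsilon> by (intro eventually_ball_finite ballI eventually_linear_gap)
      (auto simp: p_def turan_density_def)
  moreover have "\<forall>\<^sub>F n in sequentially. q + M \<le> n" by (rule eventually_ge_at_top)
  ultimately show ?thesis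
  proof eventually_elim
    case (elim n)
    show ?case
    proof (intro allI impI)
      fix a assume "a < q"
      have "ex_num (n - a - M) F + (M + real a - q) * ((p - \<epsilon>) * (real n - (real a + M))) \<le> ex_num (n - q) F"
        using elim(1)[rule_format, of "n - a - M" "M + a - q"] \<open>a < q\<close> \<open>q < M\<close> elim(3)
        by (simp add: of_nat_diff)
      then show "ex_num (n - a - M) F + a * real n + M * ((turan_density r + \<epsilon>) * n)
          < q * (real n - q) + ex_num (n - q) F"
        using bspec[OF elim(2), of a] \<open>a < q\<close> unfolding p_def[symmetric] by simp
    qed
  qed
qed

lemma EX_set_copies_high_degree_verts:
  fixes \<epsilon> :: real
  assumes F: "sgraph F" "chromatic_number F = Suc r" "0 < r"
    and u: "chromatic_number (del_vert F u) = r" and "0 < \<epsilon>" "0 < h"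
  shows "\<forall>\<^sub>F n in sequentially. \<forall>G\<in>EX_set n (copies h F). \<exists>A C.
    A = high_degree_verts G ((turan_density r + \<epsilon>) * n) \<and> C \<subseteq> verts G - A \<and> card A < h \<and>
    card C \<le> (h - card A - 1) * card (verts F) \<and> free_of F (del_verts G (A \<union> C))"
proof -
  have "chromatic_number (copies h F) = Suc r"
    using F(1,2) \<open>0 < h\<close> by (simp add: chromatic_number_copies)
  from eventually_EX_set[OF sgraph_copies[OF F(1)] this F(3)
      robust_at_high_degree_verts[OF F(1) u F(3) \<open>0 < \<epsilon>\<close>, where z = "h * (card (verts F) + 1)"]]
  show ?thesis
  proof eventually_elim
    case (elim n)
    show ?case
    proof
      fix G assume GX: "G \<in> EX_set n (copies h F)"
      then have G: "sgraph G" "card (verts G) = n" "free_of (copies h F) G"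
        by (auto simp: EX_set_def)
      define A where "A = high_degree_verts G ((turan_density r + \<epsilon>) * n)"
      have A: "A \<subseteq> verts G" by (simp add: A_def high_degree_verts_subset)
      have "\<forall>v\<in>A. robust_at F G (h * (card (verts F) + 1)) v"
        using elim GX G(2) by (auto simp: A_def)
      note few = card_less_if_free_of_copies[OF F(1) G(1) A G(3) this]
      obtain C where "C \<subseteq> verts G - A" "card C \<le> (h - card A - 1) * card (verts F)"
        "free_of F (del_verts (del_verts G A) C)"
        using ex_hitting_set[OF F(1) sgraph_induced[OF G(1)] few(2)] by auto
      then show "\<exists>A C. A = high_degree_verts G ((turan_density r + \<epsilon>) * n) \<and> C \<subseteq> verts G - A \<and> card A < h \<and>
          card C \<le> (h - card A - 1) * card (verts F) \<and> free_of F (del_verts G (A \<union> C))"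
        using few(1) A_def del_verts_del_verts by metis
    qed
  qed
qed

lemma ex_gap_constant:
  assumes "2 \<le> r" "0 < M"
  obtains \<epsilon> :: real where "0 < \<epsilon>" "\<epsilon> \<le> turan_density r" "2 * real M * \<epsilon> < 1 / r"
proof
  define \<epsilon> where "\<epsilon> = 1 / (4 * real r * M)"
  have "1 * 1 \<le> real r * M" using assms by (intro mult_mono) auto
  then have "\<epsilon> \<le> 1 / 2" by (simp add: \<epsilon>_def field_simps)
  also have "1 / 2 \<le> turan_density r" using assms(1) by (simp add: turan_density_def field_simps)
  finally show "\<epsilon> \<le> turan_density r" .
  show "0 < \<epsilon>" "2 * real M * \<epsilon> < 1 / r" using assms by (auto simp: \<epsilon>_def field_simps)
qed

lemma EX_set_copies_ex_transversal:
  assumes F: "sgraph F" "chromatic_number F = Suc r" "2 \<le> r"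
    and u: "u \<in> verts F" "chromatic_number (del_vert F u) = r"
  shows "\<forall>\<^sub>F n in sequentially. \<forall>G\<in>EX_set n (copies (Suc q) F).
    \<exists>A\<subseteq>verts G. card A = q \<and> free_of F (del_verts G A)"
proof -
  define M where "M = Suc q * card (verts F)"
  have "0 < r" "2 \<le> chromatic_number F" using F(2,3) by simp_all
  have "0 < card (verts F)" using u(1) F(1) by (auto simp: card_gt_0_iff)
  then have "Suc q * 1 \<le> M" unfolding M_def by (intro mult_left_mono) auto
  then have "q < M" "0 < M" by simp_all
  obtain \<epsilon> :: real where \<epsilon>: "0 < \<epsilon>" "\<epsilon> \<le> turan_density r" "2 * real M * \<epsilon> < 1 / r"
    by (rule ex_gap_constant[OF F(3) \<open>0 < M\<close>])
  have "\<forall>\<^sub>F n in sequentially. q + M \<le> n" by (rule eventually_ge_at_top)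
  with eventually_ex_num_gap[OF F(1,2) \<open>0 < r\<close> \<epsilon> \<open>q < M\<close>]
    EX_set_copies_high_degree_verts[OF F(1,2) \<open>0 < r\<close> u(2) \<epsilon>(1) zero_less_Suc, of q]
  show ?thesis
  proof eventually_elim
    case (elim n)
    show ?case
    proof
      fix G assume GX: "G \<in> EX_set n (copies (Suc q) F)"
      obtain A C where A: "A = high_degree_verts G ((turan_density r + \<epsilon>) * n)" "card A < Suc q"
        and C: "C \<subseteq> verts G - A" "card C \<le> (Suc q - card A - 1) * card (verts F)"
        "free_of F (del_verts G (A \<union> C))"
        using bspec[OF elim(2) GX] by blast
      have AV: "A \<subseteq> verts G" by (simp add: A(1) high_degree_verts_subset)
      have low: "degree G v \<le> (turan_density r + \<epsilon>) * n" if "v \<in> verts G - A" for v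
        using that by (auto simp: A(1) high_degree_verts_def)
      have "card C \<le> M"
        using C(2) unfolding M_def by (rule order_trans) (intro mult_right_mono, auto)
      have "card A = q"
      proof (rule ccontr)
        assume "card A \<noteq> q"
        then have "card A < q" using A(2) by simp
        then have "q * (real n - q) + ex_num (n - q) F
            \<le> ex_num (n - card A - M) F + card A * real n + M * ((turan_density r + \<epsilon>) * n)"
          using elim(3) \<open>q < M\<close> \<open>card C \<le> M\<close>
          by (intro EX_set_copies_edge_count[OF F(1) \<open>2 \<le> chromatic_number F\<close> GX AV C(1,3) low]) auto
        then show False using elim(1) \<open>card A < q\<close> by (meson not_le)
      qed
      moreover have "finite C" using C(1) GX by (auto simp: EX_set_def intro: finite_subset)
      then have "C = {}" using C(2) \<open>card A = q\<close> by simp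
      ultimately show "\<exists>A\<subseteq>verts G. card A = q \<and> free_of F (del_verts G A)" using AV C(3) by auto
    qed
  qed
qed

lemma Max_ex_num_lower_bounds:
  assumes F: "sgraph F" "2 \<le> chromatic_number F" and h: "1 \<le> h" "h \<le> n"
    and "ex_num n (copies h F) = ((h - 1) choose 2) + (h - 1) * (n - h + 1) + ex_num (n - h + 1) F"
  shows "(MAX l\<in>{1..h}. ((l - 1) choose 2) + (l - 1) * (n - l + 1) + ex_num (n - l + 1) F) =
    ex_num n (copies h F)"
proof -
  define g where "g l = ((l - 1) choose 2) + (l - 1) * (n - l + 1) + ex_num (n - l + 1) F" for l
  have "g l \<le> ex_num n (copies h F)" if "l \<in> {1..h}" for l
    unfolding g_def by (rule ex_num_copies_ge[OF F]) (use that h(2) in auto)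
  moreover have "ex_num n (copies h F) = g h" unfolding g_def by (rule assms(5))
  ultimately show ?thesis unfolding g_def[symmetric] using h(1) by (intro Max_eqI) auto
qed

theorem theorem4:
  fixes F :: "'a graph" and h :: nat
  assumes "sgraph F" and "vertex_critical F" and "chromatic_number F \<ge> 3" and "h \<ge> 2"
  shows "\<forall>\<^sub>F n in sequentially.
    ex_num n (copies h F) =
      (MAX l\<in>{1..h}. ((l - 1) choose 2) + (l - 1) * (n - l + 1) + ex_num (n - l + 1) F) \<and>
    (MAX l\<in>{1..h}. ((l - 1) choose 2) + (l - 1) * (n - l + 1) + ex_num (n - l + 1) F) =
      ((h - 1) choose 2) + (h - 1) * (n - h + 1) + ex_num (n - h + 1) F \<and>
    (\<forall>G\<in>EX_set n (copies h F). \<exists>H\<in>EX_set (n - h + 1) F.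
       isomorphic G (join (complete_graph (h - 1)) H))"
proof -
  obtain u where u: "u \<in> verts F" "chromatic_number (del_vert F u) = chromatic_number F - 1"
    using assms(2) by (auto simp: vertex_critical_def)
  have h: "Suc (h - 1) = h" "1 \<le> h" using assms(4) by simp_all
  have \<chi>: "2 \<le> chromatic_number F" "2 \<le> chromatic_number (copies h F)"
    using assms(1,3,4) by (simp_all add: chromatic_number_copies)
  have "\<forall>\<^sub>F n in sequentially. \<forall>G\<in>EX_set n (copies h F).
      \<exists>A\<subseteq>verts G. card A = h - 1 \<and> free_of F (del_verts G A)"
    using EX_set_copies_ex_transversal[OF assms(1) _ _ u, of "h - 1"] assms(3) unfolding h(1)
    by simp
  then show ?thesis using eventually_ge_at_top[of h]
  proof eventually_elim
    case (elim n)
    have ex: "ex_num n (copies h F) = ((h - 1) choose 2) + (h - 1) * (n - h + 1) + ex_num (n - h + 1) F"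
      and iso: "\<exists>H\<in>EX_set (n - h + 1) F. isomorphic G (join (complete_graph (h - 1)) H)"
      if "G \<in> EX_set n (copies h F)" for G
      using elim(1) that EX_set_copies_join[OF assms(1) \<chi>(1) h(2) elim(2) that] by blast+
    obtain G where "G \<in> EX_set n (copies h F)"
      using EX_set_not_empty[OF sgraph_copies[OF assms(1)] \<chi>(2)] by blast
    note ex = ex[OF this]
    show ?case
      unfolding Max_ex_num_lower_bounds[OF assms(1) \<chi>(1) h(2) elim(2) ex]
      using ex iso by (intro conjI ballI refl)
  qed
qed

end
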